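(* There exists a graph class $\mathcal{G}$ and a constant $c>0$ such that $\nabla_r(\mathcal{G}) \leq r+2$ for every integer $r \geq 0$, but for every integer $p \geq 1$ there is $G \in \mathcal{G}$ such that every $p$-centered coloring of $G$ requires (i.e. uses) at least $2^{c p^{1/2}}$ colors.
   Context: Graphs are finite and simple. Connected subgraphs are nonempty. Given a graph $G$ and an integer $p$, a coloring $f : V(G) \to \mathbb{N}$ is $p$-centered if for every connected subgraph $H$ of $G$, either $|f(V(H))| > p$, or there exists $i \in \mathbb{N}$ such that $|f^{-1}(i) \cap V(H)| = 1$. The number of colors used by $f$ is $|f(V(G))|$. A minor model of a graph $H$ in a graph $G$ is a collection $(I_h)_{h \in V(H)}$ of vertex-disjoint connected subgraphs of $G$ such that $h_1h_2 \in E(H)$ implies that there is an edge of $G$ with one endpoint in $I_{h_1}$ and one endpoint in $I_{h_2}$. For an integer $r \geq 0$, a minor model is $r$-shallow if every graph $I_h$ is of radius at most $r$. For a graph $G$, $\nabla_r(G)$ denotes the maximum ratio $|E(H)|/|V(H)|$ over all (nonempty) graphs $H$ that admit an $r$-shallow minor model in $G$. For a graph class $\mathcal{G}$, $\nabla_r(\mathcal{G}) = \sup \{\nabla_r(G) : G \in \mathcal{G}\}$. *)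

theory Defs
  imports "HOL-Library.Extended_Real"
begin

type_synonym 'a graph = "'a set \<times> 'a set set"

abbreviation verts :: "'a graph \<Rightarrow> 'a set" where "verts \<equiv> fst"
abbreviation edges :: "'a graph \<Rightarrow> 'a set set" where "edges \<equiv> snd"

definition simple_graph :: "'a graph \<Rightarrow> bool" where
  "simple_graph G \<longleftrightarrow> finite (verts G) \<and> (\<forall>e\<in>edges G. e \<subseteq> verts G \<and> card e = 2)"

definition subgraph :: "'a graph \<Rightarrow> 'a graph \<Rightarrow> bool" where
  "subgraph H G \<longleftrightarrow> simple_graph H \<and> verts H \<subseteq> verts G \<and> edges H \<subseteq> edges G"

definition adj :: "'a graph \<Rightarrow> 'a rel" where
  "adj G = {(u, v). {u, v} \<in> edges G}"

definition connected_graph :: "'a graph \<Rightarrow> bool" where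
  "connected_graph G \<longleftrightarrow>
     verts G \<noteq> {} \<and> (\<forall>u\<in>verts G. \<forall>v\<in>verts G. (u, v) \<in> (adj G)\<^sup>*)"

text \<open>
  The following three notions are only meaningful for finite connected graphs:
  \<open>gdist\<close> is unspecified if there is no walk from \<open>u\<close> to \<open>v\<close>.
\<close>

definition gdist :: "'a graph \<Rightarrow> 'a \<Rightarrow> 'a \<Rightarrow> nat" where
  "gdist G u v = (LEAST n. (u, v) \<in> adj G ^^ n)"

definition eccentricity :: "'a graph \<Rightarrow> 'a \<Rightarrow> nat" where
  "eccentricity G u = Max (gdist G u ` verts G)"

definition radius :: "'a graph \<Rightarrow> nat" where
  "radius G = Min (eccentricity G ` verts G)"

text \<open>Only the values of a coloring \<open>f\<close> on \<open>verts G\<close> matter.\<close>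

definition centered_coloring :: "nat \<Rightarrow> 'a graph \<Rightarrow> ('a \<Rightarrow> nat) \<Rightarrow> bool" where
  "centered_coloring p G f \<longleftrightarrow>
     (\<forall>H. subgraph H G \<and> connected_graph H \<longrightarrow>
        card (f ` verts H) > p \<or> (\<exists>i. card (f -` {i} \<inter> verts H) = 1))"

definition minor_model :: "'b graph \<Rightarrow> 'a graph \<Rightarrow> ('b \<Rightarrow> 'a graph) \<Rightarrow> bool" where
  "minor_model H G I \<longleftrightarrow>
     (\<forall>h\<in>verts H. subgraph (I h) G \<and> connected_graph (I h)) \<and>
     (\<forall>h1\<in>verts H. \<forall>h2\<in>verts H. h1 \<noteq> h2 \<longrightarrow> verts (I h1) \<inter> verts (I h2) = {}) \<and>
     (\<forall>h1 h2. {h1, h2} \<in> edges H \<longrightarrow>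
        (\<exists>u\<in>verts (I h1). \<exists>v\<in>verts (I h2). {u, v} \<in> edges G))"

definition shallow_minor_model ::
    "nat \<Rightarrow> 'b graph \<Rightarrow> 'a graph \<Rightarrow> ('b \<Rightarrow> 'a graph) \<Rightarrow> bool" where
  "shallow_minor_model r H G I \<longleftrightarrow> minor_model H G I \<and> (\<forall>h\<in>verts H. radius (I h) \<le> r)"

text \<open>
  Every finite graph is isomorphic to one on natural numbers, so it suffices to let the
  minors range over \<open>nat graph\<close>.
\<close>

definition shallow_minor_densities :: "nat \<Rightarrow> 'a graph \<Rightarrow> real set" where
  "shallow_minor_densities r G =
     {real (card (edges H)) / real (card (verts H)) | H :: nat graph.
        simple_graph H \<and> verts H \<noteq> {} \<and> (\<exists>I. shallow_minor_model r H G I)}"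

text \<open>
  The maximum exists for every nonempty finite simple graph, by the lemmas below;
  for the graph without vertices \<open>nabla\<close> is unspecified.
\<close>

definition nabla :: "nat \<Rightarrow> 'a graph \<Rightarrow> real" where
  "nabla r G = Max (shallow_minor_densities r G)"

text \<open>The supremum is taken in the extended reals, since it may be infinite.\<close>

definition nabla_class :: "nat \<Rightarrow> 'a graph set \<Rightarrow> ereal" where
  "nabla_class r \<G> = (SUP G\<in>\<G>. ereal (nabla r G))"

lemma finite_shallow_minor_densities:
  assumes "simple_graph G"
  shows "finite (shallow_minor_densities r G)"
proof -
  let ?N = "card (verts G)"
  have fG: "finite (verts G)" using assms by (simp add: simple_graph_def)
  have "shallow_minor_densities r G \<subseteq>
      (\<lambda>(m, n). real m / real n) ` ({..2 ^ ?N} \<times> {..?N})"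
  proof
    fix x assume "x \<in> shallow_minor_densities r G"
    then obtain H :: "nat graph" and I where x: "x = real (card (edges H)) / real (card (verts H))"
      and H: "simple_graph H" and I: "shallow_minor_model r H G I"
      unfolding shallow_minor_densities_def by blast
    have m: "\<forall>h\<in>verts H. verts (I h) \<subseteq> verts G \<and> verts (I h) \<noteq> {}"
      and d: "\<forall>h1\<in>verts H. \<forall>h2\<in>verts H. h1 \<noteq> h2 \<longrightarrow> verts (I h1) \<inter> verts (I h2) = {}"
      using I by (auto simp: shallow_minor_model_def minor_model_def subgraph_def connected_graph_def)
    obtain g where g: "\<forall>h\<in>verts H. g h \<in> verts (I h)"
      using m bchoice[of "verts H" "\<lambda>h v. v \<in> verts (I h)"] by blast
    have "inj_on g (verts H)"
      using g d by (metis disjoint_iff inj_onI)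
    moreover have "g ` verts H \<subseteq> verts G" using g m by blast
    ultimately have n: "card (verts H) \<le> ?N" using fG by (rule card_inj_on_le)
    have fH: "finite (verts H)" and "edges H \<subseteq> Pow (verts H)"
      using H by (auto simp: simple_graph_def)
    then have "card (edges H) \<le> 2 ^ card (verts H)"
      by (metis card_Pow card_mono finite_Pow_iff)
    also have "\<dots> \<le> 2 ^ ?N" using n by simp
    finally show "x \<in> (\<lambda>(m, n). real m / real n) ` ({..2 ^ ?N} \<times> {..?N})"
      using n x by (intro image_eqI[of _ _ "(card (edges H), card (verts H))"]) auto
  qed
  then show ?thesis by (rule finite_subset) simp
qed

lemma shallow_minor_densities_nonempty:
  assumes "verts G \<noteq> {}"
  shows "shallow_minor_densities r G \<noteq> {}"
proof -
  obtain v where v: "v \<in> verts G" using assms by blast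
  have "gdist ({v}, {}) v v = 0"
    unfolding gdist_def by (rule Least_eq_0) simp
  then have "shallow_minor_model r ({0::nat}, {}) G (\<lambda>_. ({v}, {}))"
    using v by (auto simp: shallow_minor_model_def minor_model_def subgraph_def
      connected_graph_def simple_graph_def radius_def eccentricity_def)
  moreover have "simple_graph ({0::nat}, {})" by (simp add: simple_graph_def)
  ultimately show ?thesis
    unfolding shallow_minor_densities_def by fastforce
qed

end

theory Submission
  imports Defs "HOL-Library.Sublist" "HOL-Library.Countable"
begin

text \<open>
  The class consists of one graph \<open>G\<close> for each \<open>k \<ge> 1\<close>, built from two ingredients.

  The first is a rooted tree on \<open>0, \<dots>, 2\<^sup>k - 1\<close> (the binomial tree, numbered in postorder) in which
  every vertex precedes its parent, the root is at distance at most \<open>k\<close> from every vertex, and at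
  every \<open>i\<close> at most \<open>k\<close> of the earlier vertices have their parent at \<open>i\<close> or later.  Blow this tree up
  along its numbering: take all nonempty words \<open>\<tau>\<close> of length at most \<open>2\<^sup>k\<close> over a huge alphabet, regard
  \<open>\<tau>\<close> as a copy of the number \<open>length \<tau> - 1\<close>, and join \<open>\<tau>\<close> to each of its proper prefixes that is a
  copy of a child of that number.  The second ingredient is to replace every edge by a thread with
  \<open>4 * k\<close> inner vertices.

  The density of \<open>r\<close>-shallow minors is bounded in two ways.  If \<open>r < k\<close>, then the threads are so long
  that of any two adjacent branch sets one lies inside a thread.  Such a branch set has at most two
  neighbors, so the minor has at most twice as many edges as vertices
  (\<open>shallow_minor_edges_le_subdivision\<close>).  If \<open>r \<ge> k\<close>, then the treewidth suffices: ordered by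
  the prefix relation, the graph has an elimination tree in which every vertex has at most
  \<open>k + 2\<close> proper ancestors adjacent to its descendants, so that \<open>k + 2 \<le> r + 2\<close>
  bounds the density of every minor (\<open>minor_edges_le\<close>).

  For the lower bound on the number of colors, the pigeonhole principle, applied level by level, makes
  a coloring with fewer than \<open>2\<^sup>k\<close> colors homogeneous: there is one sequence of colors such that, for
  every \<open>u\<close> other than the root, it can be read along each of two words that part right after their
  common copy of \<open>u\<close> (\<open>homogeneous_words\<close>).  Suppose that copies of \<open>u < v\<close> have the same color in it.  In each of the
  two words climb from the copies of \<open>u\<close> and of \<open>v\<close> to that of the root.  The union of these paths is
  connected, because both words share the copy of \<open>u\<close>.  No color is unique on it: all numbers on the
  paths are at least \<open>u\<close>, so everything except the shared vertex comes in two copies, and the color of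
  the shared vertex appears again at \<open>v\<close>.  Since the paths have \<open>O(k\<^sup>2)\<close> vertices, this is impossible
  for a \<open>p\<close>-centered coloring with \<open>p\<close> at least a constant times \<open>k\<^sup>2\<close> (\<open>no_color_collision\<close>).  Hence
  the \<open>2\<^sup>k\<close> colors of the sequence are distinct, and \<open>k\<close> may be chosen of order \<open>\<surd>p\<close>.
\<close>

section \<open>Counting edges of shallow minors\<close>

lemma edgeD:
  assumes "simple_graph G" "{u, v} \<in> edges G"
  shows "u \<in> verts G" "v \<in> verts G" "u \<noteq> v"
  using assms by (auto simp: simple_graph_def)

lemma nabla_le:
  assumes "simple_graph G" "verts G \<noteq> {}"
    and "\<And>(H :: nat graph) I. simple_graph H \<Longrightarrow> shallow_minor_model r H G I
           \<Longrightarrow> card (edges H) \<le> t * card (verts H)"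
  shows "nabla r G \<le> real t"
proof -
  have "x \<le> real t" if dens: "x \<in> shallow_minor_densities r G" for x
  proof -
    obtain H :: "nat graph" and I where H: "simple_graph H" "verts H \<noteq> {}"
      "shallow_minor_model r H G I" and x: "x = real (card (edges H)) / real (card (verts H))"
      using dens unfolding shallow_minor_densities_def by blast
    have "card (verts H) > 0"
      using H by (simp add: simple_graph_def card_gt_0_iff)
    moreover have "real (card (edges H)) \<le> real t * real (card (verts H))"
      using assms(3)[OF H(1) H(3)] by (metis of_nat_le_iff of_nat_mult)
    ultimately show ?thesis by (simp add: x divide_le_eq)
  qed
  then show ?thesis
    unfolding nabla_def
    using finite_shallow_minor_densities[OF assms(1)] shallow_minor_densities_nonempty[OF assms(2)]
    by (simp add: Max_le_iff)
qed

text \<open>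
  Every edge is charged to one of its ends \<open>h\<close>, and the other end then lies in \<open>D h\<close>.
\<close>

lemma card_edges_le_orientation:
  assumes H: "simple_graph H"
    and e: "\<And>e. e \<in> edges H \<Longrightarrow> \<exists>h\<in>verts H. \<exists>h'\<in>D h. e = {h, h'}"
    and D: "\<And>h. h \<in> verts H \<Longrightarrow> finite (D h) \<and> card (D h) \<le> t"
  shows "card (edges H) \<le> t * card (verts H)"
proof -
  have fin: "finite (verts H)" using H by (simp add: simple_graph_def)
  have "edges H \<subseteq> (\<Union>h\<in>verts H. (\<lambda>h'. {h, h'}) ` D h)" using e by blast
  then have "card (edges H) \<le> card (\<Union>h\<in>verts H. (\<lambda>h'. {h, h'}) ` D h)"
    using fin D by (intro card_mono) auto
  also have "\<dots> \<le> (\<Sum>h\<in>verts H. card ((\<lambda>h'. {h, h'}) ` D h))"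
    using fin by (rule card_UN_le)
  also have "\<dots> \<le> (\<Sum>h\<in>verts H. t)"
    using D by (intro sum_mono) (meson card_image_le le_trans)
  finally show ?thesis by (simp add: mult.commute)
qed

text \<open>
  A branch set that has to pass through a fixed small set \<open>X\<close> occupies an element of \<open>X\<close> of its own.
\<close>

lemma card_disjoint_family_meeting_le:
  assumes disj: "\<And>h h'. h \<in> A \<Longrightarrow> h' \<in> A \<Longrightarrow> h \<noteq> h' \<Longrightarrow> B h \<inter> B h' = {}"
    and X: "finite X"
  shows "finite {h \<in> A. B h \<inter> X \<noteq> {}} \<and> card {h \<in> A. B h \<inter> X \<noteq> {}} \<le> card X"
proof -
  let ?M = "{h \<in> A. B h \<inter> X \<noteq> {}}"
  obtain g where g: "\<forall>h\<in>?M. g h \<in> B h \<inter> X"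
    using bchoice[of ?M "\<lambda>h x. x \<in> B h \<inter> X"] by blast
  have "inj_on g ?M"
    using g disj by (intro inj_onI) (metis (no_types, lifting) IntE disjoint_iff mem_Collect_eq)
  moreover have "g ` ?M \<subseteq> X" using g by blast
  ultimately show ?thesis using X by (meson card_inj_on_le inj_on_finite)
qed

lemma connected_cut:
  assumes X: "connected_graph X" "subgraph X G" and C: "C \<subseteq> verts X" "C \<noteq> {}" "C \<noteq> verts X"
  shows "\<exists>a\<in>C. \<exists>b\<in>verts X - C. {a, b} \<in> edges G"
proof (rule ccontr)
  assume no: "\<not> ?thesis"
  obtain u v where u: "u \<in> C" and v: "v \<in> verts X" "v \<notin> C" using C by blast
  have "(u, v) \<in> (adj X)\<^sup>*" using X u v C by (auto simp: connected_graph_def)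
  then have "v \<in> C"
  proof (induction rule: rtrancl_induct)
    case base
    show ?case by (rule u)
  next
    case (step y z)
    have "{y, z} \<in> edges X" using step by (simp add: adj_def)
    moreover from this have "z \<in> verts X"
      using X(2) edgeD(2) unfolding subgraph_def by metis
    ultimately show ?case using no step X(2) unfolding subgraph_def by blast
  qed
  then show False using v by simp
qed

section \<open>Minors of graphs with a narrow elimination tree\<close>

text \<open>
  A treewidth bound in the form of an elimination tree: \<open>le x y\<close> says that \<open>x\<close> is an ancestor of \<open>y\<close>, and
  edges join comparable vertices only.  The width is the maximum size of \<open>boundary v\<close>, which together
  with \<open>v\<close> is the bag of \<open>v\<close> in the corresponding tree decomposition.
\<close>

locale elimination_tree =
  fixes G :: "'a graph" and le :: "'a \<Rightarrow> 'a \<Rightarrow> bool" and rk :: "'a \<Rightarrow> nat"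
  assumes simple: "simple_graph G"
    and refl: "\<And>x. le x x"
    and trans: "\<And>x y z. le x y \<Longrightarrow> le y z \<Longrightarrow> le x z"
    and chain: "\<And>x y z. le x z \<Longrightarrow> le y z \<Longrightarrow> le x y \<or> le y x"
    and rank: "\<And>x y. le x y \<Longrightarrow> x \<noteq> y \<Longrightarrow> rk x < rk y"
    and edge_comparable: "\<And>x y. {x, y} \<in> edges G \<Longrightarrow> le x y \<or> le y x"
begin

definition boundary :: "'a \<Rightarrow> 'a set" where
  "boundary v = {u \<in> verts G. le u v \<and> u \<noteq> v \<and> (\<exists>w\<in>verts G. le v w \<and> {u, w} \<in> edges G)}"

lemma antisym: "le x y \<Longrightarrow> le y x \<Longrightarrow> x = y"
  using rank by (metis less_asym)

text \<open>
  An edge can leave the subtree of \<open>v\<close> only upwards, since its ends are comparable.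
\<close>

lemma boundaryI:
  assumes "le v w" "\<not> le v u" "{u, w} \<in> edges G"
  shows "u \<in> boundary v"
proof -
  have "le u w" using edge_comparable[OF assms(3)] assms(1,2) trans by blast
  then have "le u v" using chain assms(1,2) by blast
  then show ?thesis
    using assms edgeD[OF simple assms(3)] refl by (auto simp: boundary_def)
qed

lemma connected_has_top:
  assumes X: "connected_graph X" "subgraph X G"
  shows "\<exists>m\<in>verts X. \<forall>b\<in>verts X. le m b"
proof -
  have "verts X \<noteq> {}" using X by (simp add: connected_graph_def)
  then obtain m where m: "m \<in> verts X" and min: "\<And>b. b \<in> verts X \<Longrightarrow> rk m \<le> rk b"
    using ex_has_least_nat[of "\<lambda>v. v \<in> verts X" _ rk] by blast
  have "{b \<in> verts X. le m b} = verts X"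
  proof (rule ccontr)
    assume "{b \<in> verts X. le m b} \<noteq> verts X"
    then obtain a b where a: "le m a" and b: "b \<in> verts X" "\<not> le m b" and ab: "{a, b} \<in> edges G"
      using connected_cut[OF X, of "{b \<in> verts X. le m b}"] m refl by auto
    have "b \<in> boundary m"
      using a b ab by (intro boundaryI[of m a]) (simp_all add: insert_commute)
    then have "rk b < rk m" by (auto simp: boundary_def intro: rank)
    then show False using min[OF b(1)] by simp
  qed
  then show ?thesis using m by blast
qed

text \<open>
  Each branch set has a topmost vertex.  If two branch sets are adjacent, their topmost vertices are
  comparable, and the branch set of the upper one, which contains a vertex outside the subtree of the
  lower one \<open>m\<close> and touches that subtree, contains a vertex of \<open>boundary m\<close>.  So at most
  \<open>card (boundary m)\<close> edges are charged to the lower branch set.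
\<close>

lemma minor_edges_le:
  assumes H: "simple_graph H" and I: "minor_model H G I"
    and width: "\<And>v. v \<in> verts G \<Longrightarrow> card (boundary v) \<le> t"
  shows "card (edges H) \<le> t * card (verts H)"
proof -
  have I': "connected_graph (I h)" "subgraph (I h) G" if "h \<in> verts H" for h
    using I that by (auto simp: minor_model_def)
  have "\<forall>h\<in>verts H. \<exists>m. m \<in> verts (I h) \<and> (\<forall>b\<in>verts (I h). le m b)"
    using connected_has_top I' by blast
  then obtain m where m: "\<And>h. h \<in> verts H \<Longrightarrow> m h \<in> verts (I h)"
    "\<And>h b. h \<in> verts H \<Longrightarrow> b \<in> verts (I h) \<Longrightarrow> le (m h) b"
    using bchoice[of "verts H" "\<lambda>h m. m \<in> verts (I h) \<and> (\<forall>b\<in>verts (I h). le m b)"] by blast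
  define D where "D h = {h' \<in> verts H. verts (I h') \<inter> boundary (m h) \<noteq> {}}" for h
  have disj: "verts (I h) \<inter> verts (I h') = {}" if "h \<in> verts H" "h' \<in> verts H" "h \<noteq> h'" for h h'
    using I that by (auto simp: minor_model_def)
  have meets: "h1 \<in> D h2"
    if h: "h1 \<in> verts H" "h2 \<in> verts H" "h1 \<noteq> h2" and up: "le (m h1) (m h2)"
      and uv: "u \<in> verts (I h1)" "v \<in> verts (I h2)" "{u, v} \<in> edges G" for h1 h2 u v
  proof -
    have "m h1 \<noteq> m h2" using m(1) disj h by (metis disjoint_iff)
    then have nle: "\<not> le (m h2) (m h1)" using up antisym by blast
    \<comment> \<open>An edge from the subtree of \<open>m h2\<close> to a vertex of \<open>I h1\<close> outside it: either \<open>{u, v}\<close> itself, or an edge by which \<open>I h1\<close> leaves the subtree.\<close>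
    have "\<exists>a b. le (m h2) a \<and> b \<in> verts (I h1) \<and> \<not> le (m h2) b \<and> {b, a} \<in> edges G"
    proof (cases "le (m h2) u")
      case True
      then obtain a b where "le (m h2) a" "b \<in> verts (I h1)" "\<not> le (m h2) b" "{a, b} \<in> edges G"
        using connected_cut[OF I'[OF h(1)], of "{b \<in> verts (I h1). le (m h2) b}"] uv m(1)[OF h(1)] nle
        by auto
      then show ?thesis by (metis insert_commute)
    next
      case False
      then show ?thesis using uv m(2)[OF h(2) uv(2)] by blast
    qed
    then show ?thesis using boundaryI h(1) unfolding D_def by blast
  qed
  show ?thesis
  proof (rule card_edges_le_orientation[OF H])
    fix e assume e: "e \<in> edges H"
    then obtain h1 h2 where e': "e = {h1, h2}" using H by (metis card_2_iff simple_graph_def)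
    have h: "h1 \<in> verts H" "h2 \<in> verts H" "h1 \<noteq> h2" using edgeD[OF H] e e' by auto
    obtain u v where uv: "u \<in> verts (I h1)" "v \<in> verts (I h2)" "{u, v} \<in> edges G"
      using I e e' unfolding minor_model_def by blast
    have "le (m h1) u" "le (m h2) v" using m(2) h uv by auto
    then have "le (m h1) (m h2) \<or> le (m h2) (m h1)"
      using edge_comparable[OF uv(3)] chain trans by metis
    then have "h1 \<in> D h2 \<or> h2 \<in> D h1"
      using meets[OF h _ uv] meets[OF h(2,1) h(3)[symmetric] _ uv(2,1)] uv(3)
      by (auto simp: insert_commute)
    then show "\<exists>h\<in>verts H. \<exists>h'\<in>D h. e = {h, h'}"
      using h e' by (metis insert_commute)
  next
    fix h assume h: "h \<in> verts H"
    have "finite (boundary (m h))" using simple by (simp add: boundary_def simple_graph_def)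
    moreover have "card (boundary (m h)) \<le> t"
      using width m(1)[OF h] I'(2)[OF h] by (auto simp: subgraph_def)
    ultimately show "finite (D h) \<and> card (D h) \<le> t"
      using card_disjoint_family_meeting_le[of "verts H" "\<lambda>h. verts (I h)" "boundary (m h)"] disj
      unfolding D_def by (meson le_trans)
  qed
qed

end

section \<open>Shallow minors of highly subdivided graphs\<close>

text \<open>
  Grow a connected set vertex by vertex: a new vertex \<open>b\<close> consumes at least one edge that left the set
  before and, having degree at most two, contributes at most one new edge.
\<close>

lemma connected_degree_two_out_edges:
  assumes G: "simple_graph G" and X: "connected_graph X" "subgraph X G"
    and deg: "\<And>v. v \<in> verts X \<Longrightarrow> card {u. {v, u} \<in> edges G} \<le> 2"
  shows "card {(u, v). u \<in> verts X \<and> v \<notin> verts X \<and> {u, v} \<in> edges G} \<le> 2"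
proof -
  define out where "out C = {(u, v). u \<in> C \<and> v \<notin> C \<and> {u, v} \<in> edges G}" for C
  define nb where "nb v = {u. {v, u} \<in> edges G}" for v
  have finG: "finite (verts G)" using G by (simp add: simple_graph_def)
  have finX: "finite (verts X)" using X by (simp add: subgraph_def simple_graph_def)
  have fin_nb: "finite (nb v)" for v
    using edgeD(2)[OF G] by (intro finite_subset[OF _ finG]) (auto simp: nb_def)
  have fin_out: "finite (out C)" for C
    using edgeD[OF G] by (intro finite_subset[OF _ finite_cartesian_product[OF finG finG]])
      (auto simp: out_def)
  have "\<exists>C\<subseteq>verts X. card C = Suc i \<and> card (out C) \<le> 2" if "Suc i \<le> card (verts X)" for i
    using that
  proof (induction i)
    case 0
    obtain v where v: "v \<in> verts X" using X(1) by (auto simp: connected_graph_def)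
    have "out {v} \<subseteq> Pair v ` nb v" by (auto simp: out_def nb_def)
    then have "card (out {v}) \<le> card (Pair v ` nb v)" using fin_nb by (intro card_mono) auto
    also have "\<dots> \<le> 2" using deg[OF v] card_image_le[OF fin_nb, of "Pair v" v] by (simp add: nb_def)
    finally show ?case using v by (intro exI[of _ "{v}"]) auto
  next
    case (Suc i)
    then obtain C where C: "C \<subseteq> verts X" "card C = Suc i" "card (out C) \<le> 2" by auto
    then obtain a b where a: "a \<in> C" and b: "b \<in> verts X" "b \<notin> C" and ab: "{a, b} \<in> edges G"
      using connected_cut[OF X, of C] Suc.prems by fastforce
    have sub: "out (insert b C) \<subseteq> (out C - {(a, b)}) \<union> Pair b ` (nb b - {a})"
      using a by (auto simp: out_def nb_def)
    have "(a, b) \<in> out C" using a b ab by (simp add: out_def)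
    then have 1: "card (out C - {(a, b)}) \<le> 1" using C(3) fin_out by (simp add: card_Diff_singleton)
    have "a \<in> nb b" using ab by (simp add: nb_def insert_commute)
    then have "card (nb b - {a}) \<le> 1"
      using deg[OF b(1)] fin_nb by (simp add: card_Diff_singleton nb_def)
    then have 2: "card (Pair b ` (nb b - {a})) \<le> 1"
      using card_image_le[of "nb b - {a}" "Pair b"] fin_nb by (meson finite_Diff le_trans)
    have "card (out (insert b C)) \<le> card ((out C - {(a, b)}) \<union> Pair b ` (nb b - {a}))"
      using sub fin_out fin_nb by (intro card_mono) auto
    also have "\<dots> \<le> 2"
      using card_Un_le[of "out C - {(a, b)}" "Pair b ` (nb b - {a})"] 1 2 by linarith
    finally show ?case
      using b C finite_subset[OF C(1) finX] by (intro exI[of _ "insert b C"]) auto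
  qed
  moreover have "card (verts X) > 0"
    using X(1) finX by (simp add: connected_graph_def card_gt_0_iff)
  ultimately obtain C where "C \<subseteq> verts X" "card C = card (verts X)" "card (out C) \<le> 2"
    by (metis Suc_pred le_refl)
  then show ?thesis using card_subset_eq[OF finX] by (metis out_def)
qed

lemma radius_center:
  assumes "connected_graph X" "simple_graph X" "radius X \<le> r"
  shows "\<exists>c\<in>verts X. \<forall>v\<in>verts X. \<exists>n\<le>r. (c, v) \<in> adj X ^^ n"
proof -
  have fin: "finite (verts X)" and ne: "verts X \<noteq> {}"
    using assms by (auto simp: simple_graph_def connected_graph_def)
  have "radius X \<in> eccentricity X ` verts X"
    unfolding radius_def using fin ne by (intro Min_in) auto
  then obtain c where c: "c \<in> verts X" "eccentricity X c \<le> r" using assms(3) by auto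
  have "gdist X c v \<le> r \<and> (c, v) \<in> adj X ^^ gdist X c v" if v: "v \<in> verts X" for v
  proof
    have "gdist X c v \<le> eccentricity X c"
      unfolding eccentricity_def using fin v by (intro Max_ge) auto
    then show "gdist X c v \<le> r" using c by simp
    have "(c, v) \<in> (adj X)\<^sup>*" using assms(1) c v by (auto simp: connected_graph_def)
    then show "(c, v) \<in> adj X ^^ gdist X c v"
      unfolding gdist_def by (metis LeastI_ex rtrancl_imp_relpow)
  qed
  then show ?thesis using c by blast
qed

text \<open>
  Here \<open>W\<close> plays the role of the original vertices of a subdivided graph.  The functions \<open>g\<close> express that
  distinct vertices of \<open>W\<close> are at distance more than \<open>4 * r + 1\<close>.  Any two vertices of adjacent branch sets
  of radius at most \<open>r\<close> are joined by a walk through both centers that is no longer than that, so one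
  of the two branch sets avoids \<open>W\<close>, and the edge is charged to it.
\<close>

lemma shallow_minor_edges_le_subdivision:
  assumes G: "simple_graph G" and H: "simple_graph H" and I: "shallow_minor_model r H G I"
    and deg: "\<And>v. v \<in> verts G \<Longrightarrow> v \<notin> W \<Longrightarrow> card {u. {v, u} \<in> edges G} \<le> 2"
    and far: "\<And>w. w \<in> W \<Longrightarrow> \<exists>g :: 'a \<Rightarrow> nat. g w = 0 \<and>
                (\<forall>u v. {u, v} \<in> edges G \<longrightarrow> g v \<le> g u + 1) \<and>
                (\<forall>w'\<in>W. w' \<noteq> w \<longrightarrow> g w' > 4 * r + 1)"
  shows "card (edges H) \<le> 2 * card (verts H)"
proof -
  have I': "connected_graph (I h)" "subgraph (I h) G" "radius (I h) \<le> r" if "h \<in> verts H" for h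
    using I that by (auto simp: shallow_minor_model_def minor_model_def)
  have disj: "verts (I h) \<inter> verts (I h') = {}" if "h \<in> verts H" "h' \<in> verts H" "h \<noteq> h'" for h h'
    using I that by (auto simp: minor_model_def shallow_minor_model_def)
  define out where "out h = {(u, v). u \<in> verts (I h) \<and> v \<notin> verts (I h) \<and> {u, v} \<in> edges G}" for h
  define D where "D h = (if verts (I h) \<inter> W = {}
      then {h' \<in> verts H. verts (I h') \<inter> snd ` out h \<noteq> {}} else {})" for h
  have free: "verts (I h1) \<inter> W = {} \<or> verts (I h2) \<inter> W = {}"
    if h: "h1 \<in> verts H" "h2 \<in> verts H" "h1 \<noteq> h2"
      and uv: "u \<in> verts (I h1)" "v \<in> verts (I h2)" "{u, v} \<in> edges G" for h1 h2 u v
  proof (rule ccontr)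
    assume "\<not> ?thesis"
    then obtain w w' where w: "w \<in> W" "w \<in> verts (I h1)" and w': "w' \<in> W" "w' \<in> verts (I h2)"
      by blast
    have "w' \<noteq> w" using disj[OF h] w w' by blast
    then obtain g :: "'a \<Rightarrow> nat" where g0: "g w = 0" and gw': "g w' > 4 * r + 1"
      and lip: "\<And>u v. {u, v} \<in> edges G \<Longrightarrow> g v \<le> g u + 1"
      using far[OF w(1)] w'(1) by blast
    have branch: "g b \<le> g a + 2 * r"
      if hh: "h \<in> verts H" and ab: "a \<in> verts (I h)" "b \<in> verts (I h)" for h a b
    proof -
      have sub: "edges (I h) \<subseteq> edges G" and simp: "simple_graph (I h)"
        using I'(2)[OF hh] by (auto simp: subgraph_def)
      have walk: "g y \<le> g x + n \<and> g x \<le> g y + n" if "(x, y) \<in> adj (I h) ^^ n" for x y n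
        using that
      proof (induction n arbitrary: y)
        case (Suc n)
        then obtain z where z: "(x, z) \<in> adj (I h) ^^ n" "{z, y} \<in> edges G"
          using sub by (auto simp: adj_def)
        then have "g y \<le> g z + 1" "g z \<le> g y + 1"
          using lip[of z y] lip[of y z] by (simp_all add: insert_commute)
        then show ?case using Suc.IH[OF z(1)] by simp
      qed simp
      obtain c where "\<forall>v\<in>verts (I h). \<exists>n\<le>r. (c, v) \<in> adj (I h) ^^ n"
        using radius_center[OF I'(1)[OF hh] simp I'(3)[OF hh]] by blast
      then obtain i j where "i \<le> r" "j \<le> r" "(c, a) \<in> adj (I h) ^^ i" "(c, b) \<in> adj (I h) ^^ j"
        using ab by blast
      then have "g b \<le> g c + r" "g c \<le> g a + r" using walk by (meson add_left_mono le_trans)+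
      then show ?thesis by simp
    qed
    have "g u \<le> 2 * r" using branch[OF h(1) w(2) uv(1)] g0 by simp
    moreover have "g w' \<le> g v + 2 * r" using branch[OF h(2) uv(2) w'(2)] .
    ultimately show False using gw' lip[OF uv(3)] by simp
  qed
  show ?thesis
  proof (rule card_edges_le_orientation[OF H])
    fix e assume e: "e \<in> edges H"
    then obtain h1 h2 where e': "e = {h1, h2}" using H by (metis card_2_iff simple_graph_def)
    have h: "h1 \<in> verts H" "h2 \<in> verts H" "h1 \<noteq> h2" using edgeD[OF H] e e' by auto
    obtain u v where uv: "u \<in> verts (I h1)" "v \<in> verts (I h2)" "{u, v} \<in> edges G"
      using I e e' unfolding shallow_minor_model_def minor_model_def by blast
    have "(u, v) \<in> out h1" "(v, u) \<in> out h2"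
      using uv disj[OF h] by (auto simp: out_def insert_commute)
    then have "verts (I h2) \<inter> snd ` out h1 \<noteq> {}" "verts (I h1) \<inter> snd ` out h2 \<noteq> {}"
      using uv by force+
    then have "h2 \<in> D h1 \<or> h1 \<in> D h2"
      using free[OF h uv] h unfolding D_def by auto
    then show "\<exists>h\<in>verts H. \<exists>h'\<in>D h. e = {h, h'}"
      using h e' by (metis insert_commute)
  next
    fix h assume h: "h \<in> verts H"
    show "finite (D h) \<and> card (D h) \<le> 2"
    proof (cases "verts (I h) \<inter> W = {}")
      case True
      have sub: "verts (I h) \<subseteq> verts G" using I'(2)[OF h] by (simp add: subgraph_def)
      have finG: "finite (verts G)" using G by (simp add: simple_graph_def)
      have fin: "finite (out h)"
        using edgeD[OF G] by (intro finite_subset[OF _ finite_cartesian_product[OF finG finG]])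
          (auto simp: out_def)
      have "card (out h) \<le> 2"
        unfolding out_def using True sub
        by (intro connected_degree_two_out_edges[OF G I'(1,2)[OF h]] deg) auto
      then have "card (snd ` out h) \<le> 2" using card_image_le[OF fin, of snd] by simp
      then show ?thesis
        using card_disjoint_family_meeting_le[of "verts H" "\<lambda>h. verts (I h)" "snd ` out h"] disj fin
          True unfolding D_def by (auto intro: le_trans)
    qed (simp add: D_def)
  qed
qed

section \<open>Homogeneous subtrees of a colored tree\<close>

text \<open>
  The words below \<open>\<tau>\<close> form a tree whose vertex \<open>\<tau>\<close> is colored by \<open>P \<tau>\<close>; the word \<open>\<sigma>\<close> describes a
  branch of this tree starting at \<open>\<tau>\<close>.
\<close>

definition realizes :: "(nat list \<Rightarrow> 'c) \<Rightarrow> nat \<Rightarrow> nat list \<Rightarrow> 'c list \<Rightarrow> nat list \<Rightarrow> bool" where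
  "realizes P N \<tau> \<rho> \<sigma> \<longleftrightarrow> set \<sigma> \<subseteq> {..<N} \<and> length \<sigma> = length \<rho> \<and>
     (\<forall>z<length \<rho>. P (\<tau> @ take (Suc z) \<sigma>) = \<rho> ! z)"

lemma realizes_Cons:
  "realizes P N \<tau> (c # \<rho>) (j # \<sigma>) \<longleftrightarrow> j < N \<and> P (\<tau> @ [j]) = c \<and> realizes P N (\<tau> @ [j]) \<rho> \<sigma>"
  unfolding realizes_def by (simp add: All_less_Suc2) blast

text \<open>
  The proof climbs from the leaves to the root.  Each child of \<open>\<tau>\<close> starts branches that realize a common
  sequence of colors; there are more children than sequences, so two children start the same one.
  Two realizing branches that part at \<open>\<tau>\<close> then pass through these two children, and branches that part
  later are found below either of them.
\<close>

lemma homogeneous_words: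
  fixes P :: "nat list \<Rightarrow> 'c"
  assumes T: "finite T" "card T \<le> K" "0 < K" and N: "K ^ m < N"
    and P: "\<And>\<tau>. \<tau> \<noteq> [] \<Longrightarrow> set \<tau> \<subseteq> {..<N} \<Longrightarrow> length \<tau> \<le> m \<Longrightarrow> P \<tau> \<in> T"
  shows "set \<tau> \<subseteq> {..<N} \<Longrightarrow> length \<tau> + d = m \<Longrightarrow>
    \<exists>\<rho>. length \<rho> = d \<and> set \<rho> \<subseteq> T \<and> (\<exists>\<sigma>. realizes P N \<tau> \<rho> \<sigma>) \<and>
      (\<forall>i<d. \<exists>\<sigma> \<sigma>'. realizes P N \<tau> \<rho> \<sigma> \<and> realizes P N \<tau> \<rho> \<sigma>' \<and>
         take i \<sigma> = take i \<sigma>' \<and> \<sigma> ! i \<noteq> \<sigma>' ! i)"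
proof (induction d arbitrary: \<tau>)
  case 0
  show ?case by (intro exI[of _ "[]"]) (simp add: realizes_def)
next
  case (Suc d)
  let ?good = "\<lambda>\<tau> d \<rho>. length \<rho> = d \<and> set \<rho> \<subseteq> T \<and> (\<exists>\<sigma>. realizes P N \<tau> \<rho> \<sigma>) \<and>
      (\<forall>i<d. \<exists>\<sigma> \<sigma>'. realizes P N \<tau> \<rho> \<sigma> \<and> realizes P N \<tau> \<rho> \<sigma>' \<and>
         take i \<sigma> = take i \<sigma>' \<and> \<sigma> ! i \<noteq> \<sigma>' ! i)"
  have "\<forall>j\<in>{..<N}. \<exists>\<rho>. ?good (\<tau> @ [j]) d \<rho>"
    using Suc.prems by (intro ballI Suc.IH) auto
  from bchoice[OF this] obtain R where "\<forall>j\<in>{..<N}. ?good (\<tau> @ [j]) d (R j)" ..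
  then have R: "?good (\<tau> @ [j]) d (R j)" if "j < N" for j
    using that lessThan_iff by blast
  define h where "h j = P (\<tau> @ [j]) # R j" for j
  let ?L = "{xs. set xs \<subseteq> T \<and> length xs = Suc d}"
  have h: "h ` {..<N} \<subseteq> ?L"
  proof (rule image_subsetI)
    fix j assume "j \<in> {..<N}"
    then have j: "j < N" by simp
    have "length (R j) = d" "set (R j) \<subseteq> T" using R[OF j] by blast+
    moreover have "P (\<tau> @ [j]) \<in> T" using Suc.prems j by (intro P) auto
    ultimately show "h j \<in> ?L" by (simp add: h_def)
  qed
  have "card (h ` {..<N}) \<le> card ?L" using h T(1) finite_lists_length_eq by (intro card_mono) auto
  also have "\<dots> = card T ^ Suc d" using card_lists_length_eq[OF T(1)] by blast
  also have "\<dots> \<le> K ^ Suc d" using T(2) by (rule power_mono) simp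
  also have "\<dots> \<le> K ^ m" using T(3) Suc.prems by (intro power_increasing) auto
  also have "\<dots> < card {..<N}" using N by simp
  finally have "\<not> inj_on h {..<N}" by (rule pigeonhole)
  then obtain j j' where j: "j < N" "j' < N" "j \<noteq> j'" "h j = h j'" by (auto simp: inj_on_def)
  have eq: "P (\<tau> @ [j']) = P (\<tau> @ [j])" "R j' = R j" using j by (auto simp: h_def)
  note good = R[OF j(1)] and good' = R[OF j(2), unfolded eq]
  show ?case
  proof (intro exI[of _ "h j"] conjI allI impI)
    show "length (h j) = Suc d" "set (h j) \<subseteq> T" using h j(1) by auto
    show "\<exists>\<sigma>. realizes P N \<tau> (h j) \<sigma>"
      using good j(1) unfolding h_def by (meson realizes_Cons)
    fix i assume i: "i < Suc d"
    show "\<exists>\<sigma> \<sigma>'. realizes P N \<tau> (h j) \<sigma> \<and> realizes P N \<tau> (h j) \<sigma>' \<and>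
        take i \<sigma> = take i \<sigma>' \<and> \<sigma> ! i \<noteq> \<sigma>' ! i"
    proof (cases i)
      case 0
      obtain \<sigma> \<sigma>' where "realizes P N (\<tau> @ [j]) (R j) \<sigma>" "realizes P N (\<tau> @ [j']) (R j) \<sigma>'"
        using good good' by blast
      then show ?thesis using 0 j eq
        by (intro exI[of _ "j # \<sigma>"] exI[of _ "j' # \<sigma>'"]) (simp add: h_def realizes_Cons)
    next
      case (Suc i')
      then obtain \<sigma> \<sigma>' where "realizes P N (\<tau> @ [j]) (R j) \<sigma>" "realizes P N (\<tau> @ [j]) (R j) \<sigma>'"
        "take i' \<sigma> = take i' \<sigma>'" "\<sigma> ! i' \<noteq> \<sigma>' ! i'"
        using good i by auto
      then show ?thesis using Suc j
        by (intro exI[of _ "j # \<sigma>"] exI[of _ "j # \<sigma>'"]) (simp add: h_def realizes_Cons)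
    qed
  qed
qed

section \<open>The binomial tree in postorder\<close>

text \<open>
  The tree for \<open>Suc k\<close> consists of two consecutive copies of the tree for \<open>k\<close>, the root of the first copy
  being made a child of the root of the second.  On the \<open>k\<close> binary digits of \<open>x\<close>, \<open>parent\<close> turns the lowest
  zero into a one, and the root \<open>2\<^sup>k - 1\<close>, which has no zero, is its own parent.  Making the root a fixed
  point lets exactly \<open>k\<close> steps lead to it from everywhere.
\<close>

primrec parent :: "nat \<Rightarrow> nat \<Rightarrow> nat" where
  "parent 0 x = x"
| "parent (Suc k) x = (if Suc x < 2 ^ k then parent k x
     else if Suc x = 2 ^ k then 2 ^ Suc k - 1 else 2 ^ k + parent k (x - 2 ^ k))"

text \<open>
  The number of zeros among the \<open>k\<close> binary digits of \<open>x\<close>.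
\<close>

primrec depth :: "nat \<Rightarrow> nat \<Rightarrow> nat" where
  "depth 0 x = 0"
| "depth (Suc k) x = (if x < 2 ^ k then Suc (depth k x) else depth k (x - 2 ^ k))"

lemma parent_less: "x < 2 ^ k \<Longrightarrow> parent k x < 2 ^ k"
proof (induction k arbitrary: x)
  case (Suc k)
  have "parent k (x - 2 ^ k) < 2 ^ k" if "2 ^ k \<le> x"
    using Suc.prems that by (intro Suc.IH) auto
  then show ?case using Suc.IH[of x] by auto
qed simp

lemma parent_root: "parent k (2 ^ k - 1) = 2 ^ k - 1"
proof (induction k)
  case (Suc k)
  have "(2::nat) ^ Suc k - 1 - 2 ^ k = 2 ^ k - 1" by simp
  moreover have "\<not> Suc (2 ^ Suc k - 1) < (2::nat) ^ k" "Suc (2 ^ Suc k - 1) \<noteq> (2::nat) ^ k"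
    by simp_all
  ultimately show ?case using Suc.IH by simp
qed simp

lemma parent_greater: "Suc x < 2 ^ k \<Longrightarrow> x < parent k x"
proof (induction k arbitrary: x)
  case (Suc k)
  have "x - 2 ^ k < parent k (x - 2 ^ k)" if "2 ^ k \<le> x"
    using Suc.prems that by (intro Suc.IH) auto
  then show ?case using Suc.IH[of x] by auto
qed simp

lemma depth_le: "depth k x \<le> k"
  by (induction k arbitrary: x) (auto intro: le_SucI)

lemma depth_root: "depth k (2 ^ k - 1) = 0"
proof (induction k)
  case (Suc k)
  have "(2::nat) ^ Suc k - 1 - 2 ^ k = 2 ^ k - 1" by simp
  moreover have "\<not> 2 ^ Suc k - 1 < (2::nat) ^ k" by simp
  ultimately show ?case using Suc.IH by simp
qed simp

lemma depth_parent: "Suc x < 2 ^ k \<Longrightarrow> depth k (parent k x) < depth k x"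
proof (induction k arbitrary: x)
  case (Suc k)
  consider "Suc x < 2 ^ k" | "Suc x = 2 ^ k" | "2 ^ k \<le> x" by linarith
  then show ?case
  proof cases
    case 1
    then show ?thesis using Suc.IH[of x] parent_less[of x k] by simp
  next
    case 2
    then show ?thesis using depth_root[of "Suc k"] by simp
  next
    case 3
    then have "depth k (parent k (x - 2 ^ k)) < depth k (x - 2 ^ k)"
      using Suc.prems by (intro Suc.IH) auto
    then show ?thesis using 3 by simp
  qed
qed simp

lemma parent_iterate: "x < 2 ^ k \<Longrightarrow> depth k x \<le> m \<Longrightarrow> (parent k ^^ m) x = 2 ^ k - 1"
proof (induction m arbitrary: x)
  case 0
  then show ?case using depth_parent[of x k] by (cases "Suc x < 2 ^ k") auto
next
  case (Suc m)
  have "depth k (parent k x) \<le> m"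
  proof (cases "Suc x < 2 ^ k")
    case True
    then show ?thesis using depth_parent[OF True] Suc.prems by simp
  next
    case False
    then have "x = 2 ^ k - 1" using Suc.prems by simp
    then show ?thesis by (simp only: parent_root depth_root)
  qed
  then show ?case
    using Suc.IH[of "parent k x"] parent_less Suc.prems by (simp add: funpow_swap1)
qed

text \<open>
  When the numbering has reached \<open>i\<close> in the second copy of the tree for \<open>k\<close>, the first copy contributes
  nothing but its root.  So each doubling opens at most one more vertex.
\<close>

lemma card_open_siblings_le:
  "i < 2 ^ k \<Longrightarrow> card {x. x < i \<and> i \<le> parent k x} \<le> k"
proof (induction k arbitrary: i)
  case (Suc k)
  show ?case
  proof (cases "i < 2 ^ k")
    case True
    then have "{x. x < i \<and> i \<le> parent (Suc k) x} = {x. x < i \<and> i \<le> parent k x}" by auto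
    then show ?thesis using Suc.IH[OF True] by simp
  next
    case False
    let ?A = "{x. x < i - 2 ^ k \<and> i - 2 ^ k \<le> parent k x}"
    have "{x. x < i \<and> i \<le> parent (Suc k) x} \<subseteq> insert (2 ^ k - 1) ((+) (2 ^ k) ` ?A)"
    proof
      fix x assume x: "x \<in> {x. x < i \<and> i \<le> parent (Suc k) x}"
      consider "Suc x < 2 ^ k" | "Suc x = 2 ^ k" | "2 ^ k \<le> x" by linarith
      then show "x \<in> insert (2 ^ k - 1) ((+) (2 ^ k) ` ?A)"
      proof cases
        case 1
        then show ?thesis using x False parent_less[of x k] by simp
      next
        case 2
        then have "x = 2 ^ k - 1" by simp
        then show ?thesis by simp
      next
        case 3
        then have "x - 2 ^ k \<in> ?A" using x False by auto
        then show ?thesis using 3 by (intro insertI2 image_eqI[of _ _ "x - 2 ^ k"]) auto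
      qed
    qed
    then have "card {x. x < i \<and> i \<le> parent (Suc k) x} \<le> card (insert (2 ^ k - 1) ((+) (2 ^ k) ` ?A))"
      by (intro card_mono) auto
    also have "\<dots> \<le> Suc (card ((+) (2 ^ k) ` ?A))" by (rule card_insert_le_m1) auto
    also have "\<dots> \<le> Suc (card ?A)" using card_image_le[of ?A "(+) (2 ^ k)"] by simp
    also have "\<dots> \<le> Suc k" using Suc.IH[of "i - 2 ^ k"] Suc.prems False by simp
    finally show ?thesis .
  qed
qed simp

section \<open>The graphs\<close>

text \<open>
  \<open>Orig \<tau>\<close> is a vertex of the graph before subdivision, and \<open>Sub \<tau> x j\<close> is the vertex at distance \<open>j\<close> from
  \<open>Orig \<tau>\<close> on the thread from there to the prefix of \<open>\<tau>\<close> that is a copy of \<open>x\<close>.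
\<close>

datatype node = Orig "nat list" | Sub "nat list" nat nat

instance node :: countable
  by countable_datatype

locale blowup =
  fixes k N :: nat
  assumes k: "0 < k" and N: "0 < N"
begin

definition words :: "nat list set" where
  "words = {\<tau>. \<tau> \<noteq> [] \<and> set \<tau> \<subseteq> {..<N} \<and> length \<tau> \<le> 2 ^ k}"

text \<open>
  A word is a copy of its length minus one, so \<open>\<tau>\<close> is joined to a copy of \<open>x\<close>, namely its prefix of length
  \<open>Suc x\<close>, if \<open>length \<tau> - 1\<close> is the parent of \<open>x\<close>.  The condition \<open>Suc x < 2 ^ k\<close> excludes the root.
\<close>

definition joined :: "nat list \<Rightarrow> nat \<Rightarrow> bool" where
  "joined \<tau> x \<longleftrightarrow> \<tau> \<in> words \<and> Suc x < 2 ^ k \<and> length \<tau> = Suc (parent k x)"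

inductive arc :: "node \<Rightarrow> node \<Rightarrow> bool" where
  first: "joined \<tau> x \<Longrightarrow> arc (Orig \<tau>) (Sub \<tau> x 1)"
| inner: "joined \<tau> x \<Longrightarrow> 1 \<le> j \<Longrightarrow> j < 4 * k \<Longrightarrow> arc (Sub \<tau> x j) (Sub \<tau> x (Suc j))"
| last: "joined \<tau> x \<Longrightarrow> arc (Sub \<tau> x (4 * k)) (Orig (take (Suc x) \<tau>))"

definition nodes :: "node set" where
  "nodes = Orig ` words \<union> {Sub \<tau> x j | \<tau> x j. joined \<tau> x \<and> 1 \<le> j \<and> j \<le> 4 * k}"

definition graph_on :: "node set \<Rightarrow> nat graph" where
  "graph_on X = (to_nat ` X, {{to_nat a, to_nat b} | a b. arc a b \<and> a \<in> X \<and> b \<in> X})"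

abbreviation G :: "nat graph" where "G \<equiv> graph_on nodes"

lemma Orig_nodes [simp]: "Orig \<tau> \<in> nodes \<longleftrightarrow> \<tau> \<in> words"
  by (auto simp: nodes_def)

lemma Sub_nodes [simp]: "Sub \<tau> x j \<in> nodes \<longleftrightarrow> joined \<tau> x \<and> 1 \<le> j \<and> j \<le> 4 * k"
  by (auto simp: nodes_def)

lemma joined_length: "joined \<tau> x \<Longrightarrow> Suc x < length \<tau>"
  using parent_greater by (simp add: joined_def)

lemma finite_nodes: "finite nodes"
proof -
  have "words \<subseteq> {\<tau>. set \<tau> \<subseteq> {..<N} \<and> length \<tau> \<le> 2 ^ k}" by (auto simp: words_def)
  then have fin: "finite words" using finite_lists_length_le[of "{..<N}"] finite_subset by blast
  have "nodes \<subseteq> Orig ` words \<union>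
      (\<lambda>(\<tau>, x, j). Sub \<tau> x j) ` (words \<times> {..<2 ^ k} \<times> {..4 * k})"
    unfolding nodes_def joined_def by force
  then show ?thesis using fin by (auto intro: finite_subset)
qed

lemma arc_irrefl: "\<not> arc a a"
  by (auto elim: arc.cases)

lemma edge_graph_on [simp]:
  "{to_nat a, to_nat b} \<in> edges (graph_on X) \<longleftrightarrow> a \<in> X \<and> b \<in> X \<and> (arc a b \<or> arc b a)"
  by (auto simp: graph_on_def doubleton_eq_iff)

lemma edge_graph_onE:
  assumes "{u, v} \<in> edges (graph_on X)"
  obtains a b where "u = to_nat a" "v = to_nat b" "a \<in> X" "b \<in> X" "arc a b \<or> arc b a"
  using assms by (auto simp: graph_on_def doubleton_eq_iff)

lemma verts_graph_on [simp]: "verts (graph_on X) = to_nat ` X"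
  by (simp add: graph_on_def)

lemma simple_graph_on: "X \<subseteq> nodes \<Longrightarrow> simple_graph (graph_on X)"
  using finite_subset[OF _ finite_nodes, of X] arc_irrefl
  by (auto simp: simple_graph_def graph_on_def card_2_iff')

lemma subgraph_on: "X \<subseteq> nodes \<Longrightarrow> subgraph (graph_on X) G"
  using simple_graph_on by (auto simp: subgraph_def graph_on_def)

section \<open>The density of their minors\<close>

lemma card_pair_le: "card {a, b} \<le> 2"
  by (simp add: card_insert_if)

fun word :: "node \<Rightarrow> nat list" where
  "word (Orig \<tau>) = \<tau>"
| "word (Sub \<tau> x j) = \<tau>"

text \<open>
  The elimination tree.  The words are ordered by the prefix relation, and each thread hangs as a chain
  below its longer end \<open>\<tau>\<close>.  The thread then ends with an edge back to an ancestor of \<open>\<tau>\<close>, and no vertex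
  of a thread has a branch vertex below it.
\<close>

fun above :: "node \<Rightarrow> node \<Rightarrow> bool" where
  "above (Orig \<sigma>) b = prefix \<sigma> (word b)"
| "above (Sub \<sigma> x j) (Sub \<tau> y i) = (\<sigma> = \<tau> \<and> x = y \<and> j \<le> i)"
| "above (Sub \<sigma> x j) (Orig \<tau>) = False"

fun level :: "node \<Rightarrow> nat" where
  "level (Orig \<tau>) = length \<tau>"
| "level (Sub \<tau> x j) = Suc (length \<tau> + j)"

lemma above_refl: "above a a"
  by (cases a) auto

lemma above_trans: "above a b \<Longrightarrow> above b c \<Longrightarrow> above a c"
  by (cases a; cases b; cases c) auto

lemma above_chain: "above a c \<Longrightarrow> above b c \<Longrightarrow> above a b \<or> above b a"
  by (cases a; cases b; cases c) (auto dest: prefix_same_cases)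

lemma above_level: "above a b \<Longrightarrow> a \<noteq> b \<Longrightarrow> level a < level b"
  by (cases a; cases b)
    (auto dest: prefix_length_le intro: prefix_length_less simp: strict_prefix_def le_imp_less_Suc trans_le_add1)

lemma arc_above: "arc a b \<Longrightarrow> above a b \<or> above b a"
  by (auto elim!: arc.cases simp: take_is_prefix)

text \<open>
  Outside the range of \<open>to_nat\<close> the function \<open>from_nat\<close> is not injective; there \<open>le\<close> is equality, so that it
  is a partial order on all of \<open>nat\<close>.
\<close>

definition le :: "nat \<Rightarrow> nat \<Rightarrow> bool" where
  "le u v \<longleftrightarrow> u = v \<or> (\<exists>a b. u = to_nat a \<and> v = to_nat b \<and> above a b)"

lemma le_to_nat [simp]: "le (to_nat a) (to_nat b) \<longleftrightarrow> above a b"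
  by (auto simp: le_def above_refl)

sublocale elimination_tree G le "\<lambda>u. level (from_nat u)"
proof
  show "simple_graph G" by (rule simple_graph_on) simp
  show "le x y \<or> le y x" if "{x, y} \<in> edges G" for x y
    using that arc_above by (elim edge_graph_onE) auto
  show "le x y \<or> le y x" if "le x z" "le y z" for x y z
    using that above_chain unfolding le_def by (metis from_nat_to_nat)
  show "le x z" if "le x y" "le y z" for x y z
    using that above_trans unfolding le_def by (metis from_nat_to_nat)
  show "level (from_nat x) < level (from_nat y)" if "le x y" "x \<noteq> y" for x y
    using that above_level unfolding le_def by auto
qed (simp add: le_def)

lemma boundaryE:
  assumes "u \<in> boundary (to_nat b)"
  obtains a c where "u = to_nat a" "a \<noteq> b" "above a b" "above b c" "c \<in> nodes" "arc a c \<or> arc c a"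
proof -
  obtain w where "le u (to_nat b)" "u \<noteq> to_nat b" "le (to_nat b) w" "{u, w} \<in> edges G"
    using assms unfolding boundary_def by blast
  from \<open>{u, w} \<in> edges G\<close> obtain a c
    where "u = to_nat a" "w = to_nat c" "c \<in> nodes" "arc a c \<or> arc c a"
    by (rule edge_graph_onE)
  then show ?thesis
    using that[of a c] \<open>le u (to_nat b)\<close> \<open>u \<noteq> to_nat b\<close> \<open>le (to_nat b) w\<close> by auto
qed

text \<open>
  An edge from above \<open>Orig \<tau>\<close> to below it is the last edge of a thread that starts at an extension of \<open>\<tau>\<close>
  and ends at a proper prefix of \<open>\<tau>\<close>.  The prefixes that can occur are copies of those \<open>x\<close> whose parent is
  still to come, which \<open>card_open_siblings_le\<close> counts.
\<close>

lemma boundary_Orig: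
  assumes \<tau>: "\<tau> \<in> words"
  shows "boundary (to_nat (Orig \<tau>)) \<subseteq> (\<lambda>x. to_nat (Orig (take (Suc x) \<tau>))) `
    {x. x < length \<tau> - 1 \<and> length \<tau> - 1 \<le> parent k x}"
proof
  fix u assume "u \<in> boundary (to_nat (Orig \<tau>))"
  then obtain a c where u: "u = to_nat a" and a: "a \<noteq> Orig \<tau>" "above a (Orig \<tau>)"
    and c: "above (Orig \<tau>) c" and ac: "arc a c \<or> arc c a"
    by (rule boundaryE)
  obtain \<sigma> where \<sigma>: "a = Orig \<sigma>" "strict_prefix \<sigma> \<tau>"
    using a by (cases a) (auto simp: strict_prefix_def)
  have "\<exists>x \<tau>'. joined \<tau>' x \<and> \<sigma> = take (Suc x) \<tau>' \<and> prefix \<tau> \<tau>'"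
    using ac
  proof
    assume "arc a c"
    then have "c = Sub \<sigma> (case c of Sub _ x _ \<Rightarrow> x) 1" using \<sigma>(1) by (auto elim: arc.cases)
    then show ?thesis using c \<sigma>(2) by (cases c) (auto simp: strict_prefix_def prefix_order.eq_iff)
  next
    assume "arc c a"
    then show ?thesis using c \<sigma>(1) by cases auto
  qed
  then obtain x \<tau>' where x: "joined \<tau>' x" "\<sigma> = take (Suc x) \<tau>'" and p: "prefix \<tau> \<tau>'" by blast
  have "length \<sigma> < length \<tau>" using \<sigma>(2) by (rule prefix_length_less)
  moreover have "length \<sigma> = Suc x" using x joined_length by simp
  moreover have "length \<tau> \<le> Suc (parent k x)"
    using prefix_length_le[OF p] x by (simp add: joined_def)
  moreover from calculation have "\<sigma> = take (Suc x) \<tau>" using p x(2) by (auto simp: prefix_def)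
  ultimately show "u \<in> (\<lambda>x. to_nat (Orig (take (Suc x) \<tau>))) `
      {x. x < length \<tau> - 1 \<and> length \<tau> - 1 \<le> parent k x}"
    using u \<sigma>(1) by auto
qed

text \<open>
  Below a vertex of a thread there is only the rest of the thread.  It is adjacent to the preceding
  vertex of the thread (which is \<open>Orig \<tau>\<close> at the beginning) and to the end of the thread.
\<close>

lemma boundary_Sub:
  "boundary (to_nat (Sub \<tau> x j)) \<subseteq>
     {to_nat (if j \<le> 1 then Orig \<tau> else Sub \<tau> x (j - 1)), to_nat (Orig (take (Suc x) \<tau>))}"
proof
  fix u assume "u \<in> boundary (to_nat (Sub \<tau> x j))"
  then obtain a c where u: "u = to_nat a" and a: "a \<noteq> Sub \<tau> x j" "above a (Sub \<tau> x j)"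
    and c: "above (Sub \<tau> x j) c" and ac: "arc a c \<or> arc c a"
    by (rule boundaryE)
  obtain i where i: "c = Sub \<tau> x i" "j \<le> i" using c by (cases c) auto
  have "\<not> arc (Sub \<tau> x i) (Sub \<tau> x m)" if "m < j" for m
    using that i by (auto elim: arc.cases)
  then show "u \<in> {to_nat (if j \<le> 1 then Orig \<tau> else Sub \<tau> x (j - 1)), to_nat (Orig (take (Suc x) \<tau>))}"
    using ac a u i by (cases a) (auto elim!: arc.cases)
qed

lemma card_boundary_le:
  assumes "v \<in> verts G"
  shows "card (boundary v) \<le> k + 2"
proof -
  obtain a where v: "v = to_nat a" and a: "a \<in> nodes" using assms by auto
  show ?thesis
  proof (cases a)
    case (Orig \<tau>)
    let ?A = "{x. x < length \<tau> - 1 \<and> length \<tau> - 1 \<le> parent k x}"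
    have \<tau>: "\<tau> \<in> words" using a Orig by simp
    have "card (boundary v) \<le> card ((\<lambda>x. to_nat (Orig (take (Suc x) \<tau>))) ` ?A)"
      using boundary_Orig[OF \<tau>] v Orig by (intro card_mono) auto
    also have "\<dots> \<le> card ?A" by (rule card_image_le) simp
    also have "\<dots> \<le> k" using \<tau> by (intro card_open_siblings_le) (cases \<tau>; simp add: words_def)
    finally show ?thesis by simp
  next
    case (Sub \<tau> x j)
    have "card (boundary v) \<le> card {to_nat (if j \<le> 1 then Orig \<tau> else Sub \<tau> x (j - 1)), to_nat (Orig (take (Suc x) \<tau>))}"
      using boundary_Sub v Sub by (intro card_mono) auto
    also have "\<dots> \<le> 2" by (rule card_pair_le)
    finally show ?thesis by simp
  qed
qed

lemma degree_Sub:
  "card {u. {to_nat (Sub \<tau> x j), u} \<in> edges G} \<le> 2"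
proof -
  let ?S = "{to_nat (if j \<le> 1 then Orig \<tau> else Sub \<tau> x (j - 1)),
    to_nat (if j = 4 * k then Orig (take (Suc x) \<tau>) else Sub \<tau> x (Suc j))}"
  have "{u. {to_nat (Sub \<tau> x j), u} \<in> edges G} \<subseteq> ?S"
  proof
    fix u assume "u \<in> {u. {to_nat (Sub \<tau> x j), u} \<in> edges G}"
    then have "{to_nat (Sub \<tau> x j), u} \<in> edges G" by simp
    then show "u \<in> ?S"
      by (elim edge_graph_onE) (auto elim!: arc.cases)
  qed
  then have "card {u. {to_nat (Sub \<tau> x j), u} \<in> edges G} \<le> card ?S" by (intro card_mono) auto
  also have "\<dots> \<le> 2" by (rule card_pair_le)
  finally show ?thesis .
qed

text \<open>
  The distance from \<open>Orig \<sigma>\<close>, truncated at the length \<open>4 * k + 1\<close> of a subdivided edge.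
\<close>

fun far :: "nat list \<Rightarrow> node \<Rightarrow> nat" where
  "far \<sigma> (Orig \<tau>) = (if \<tau> = \<sigma> then 0 else 4 * k + 1)"
| "far \<sigma> (Sub \<tau> x j) = (if \<tau> = \<sigma> then j
     else if take (Suc x) \<tau> = \<sigma> then 4 * k + 1 - j else 4 * k + 1)"

lemma far_arc:
  assumes "arc a b"
  shows "far \<sigma> a \<le> far \<sigma> b + 1 \<and> far \<sigma> b \<le> far \<sigma> a + 1"
  using assms
proof cases
  case (last \<tau> x)
  then have "take (Suc x) \<tau> \<noteq> \<tau>" using joined_length[of \<tau> x] by (metis length_take min.absorb4 nat_neq_iff)
  then show ?thesis using last by auto
qed auto

lemma minor_edges_le_two:
  assumes r: "r < k" and H: "simple_graph H" and I: "shallow_minor_model r H G I"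
  shows "card (edges H) \<le> 2 * card (verts H)"
proof (rule shallow_minor_edges_le_subdivision[OF simple H I, of "range (\<lambda>\<tau>. to_nat (Orig \<tau>))"])
  fix v assume "v \<in> verts G" "v \<notin> range (\<lambda>\<tau>. to_nat (Orig \<tau>))"
  then obtain \<tau> x j where "v = to_nat (Sub \<tau> x j)" by (auto simp: image_iff) (metis node.exhaust)
  then show "card {u. {v, u} \<in> edges G} \<le> 2" using degree_Sub by simp
next
  fix w assume "w \<in> range (\<lambda>\<tau>. to_nat (Orig \<tau>))"
  then obtain \<sigma> where w: "w = to_nat (Orig \<sigma>)" by blast
  show "\<exists>g :: nat \<Rightarrow> nat. g w = 0 \<and> (\<forall>u v. {u, v} \<in> edges G \<longrightarrow> g v \<le> g u + 1) \<and>
      (\<forall>w'\<in>range (\<lambda>\<tau>. to_nat (Orig \<tau>)). w' \<noteq> w \<longrightarrow> g w' > 4 * r + 1)"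
  proof (intro exI[of _ "\<lambda>u. far \<sigma> (from_nat u)"] conjI allI impI)
    fix u v assume "{u, v} \<in> edges G"
    then show "far \<sigma> (from_nat v) \<le> far \<sigma> (from_nat u) + 1"
      using far_arc by (elim edge_graph_onE) auto
  qed (use r w in auto)
qed

lemma nodes_nonempty: "nodes \<noteq> {}"
proof -
  have "Orig [0] \<in> nodes" using N by (simp add: words_def)
  then show ?thesis by blast
qed

text \<open>
  The first bound serves small \<open>r\<close>, where only the length of the threads helps; from \<open>r = k\<close> on the
  width \<open>k + 2\<close> is small enough.
\<close>

lemma nabla_G: "nabla r G \<le> real r + 2"
proof (cases "r < k")
  case True
  have "nabla r G \<le> real 2"
    using minor_edges_le_two[OF True] nodes_nonempty by (intro nabla_le[OF simple]) auto
  then show ?thesis by simp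
next
  case False
  have "nabla r G \<le> real (k + 2)"
  proof (rule nabla_le[OF simple])
    show "verts G \<noteq> {}" using nodes_nonempty by simp
    show "card (edges H) \<le> (k + 2) * card (verts H)"
      if "simple_graph H" "shallow_minor_model r H G I" for H :: "nat graph" and I
      by (rule minor_edges_le[OF that(1), where I = I, OF _ card_boundary_le])
        (use that(2) in \<open>simp add: shallow_minor_model_def\<close>)
  qed
  then show ?thesis using False by simp
qed

section \<open>Colors of the branch vertices\<close>

text \<open>
  All the colors that belong to \<open>\<tau>\<close>: its own and those of the threads starting there.  The color of \<open>Orig \<tau>\<close>
  fills the places of threads that do not exist, which keeps the entries among the colors in use and
  the length independent of \<open>\<tau>\<close>.
\<close>

definition profile :: "(nat \<Rightarrow> nat) \<Rightarrow> nat list \<Rightarrow> nat list" where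
  "profile f \<tau> = f (to_nat (Orig \<tau>)) #
     map (\<lambda>(x, j). f (to_nat (if Sub \<tau> x j \<in> nodes then Sub \<tau> x j else Orig \<tau>)))
       (List.product [0..<2 ^ k] [0..<Suc (4 * k)])"

lemma length_profile: "length (profile f \<tau>) = Suc (2 ^ k * Suc (4 * k))"
  by (simp add: profile_def)

lemma set_profile: "\<tau> \<in> words \<Longrightarrow> set (profile f \<tau>) \<subseteq> f ` verts G"
  by (auto simp: profile_def split: if_splits)

lemma profile_eqD:
  assumes "profile f \<tau> = profile f \<tau>'"
  shows "f (to_nat (Orig \<tau>)) = f (to_nat (Orig \<tau>'))"
    and "Sub \<tau> x j \<in> nodes \<Longrightarrow> Sub \<tau>' x j \<in> nodes
           \<Longrightarrow> f (to_nat (Sub \<tau> x j)) = f (to_nat (Sub \<tau>' x j))"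
proof -
  show "f (to_nat (Orig \<tau>)) = f (to_nat (Orig \<tau>'))"
    using assms by (simp add: profile_def)
  assume nodes: "Sub \<tau> x j \<in> nodes" "Sub \<tau>' x j \<in> nodes"
  then have "(x, j) \<in> set (List.product [0..<2 ^ k] [0..<Suc (4 * k)])"
    by (auto simp: joined_def)
  then show "f (to_nat (Sub \<tau> x j)) = f (to_nat (Sub \<tau>' x j))"
    using assms nodes unfolding profile_def list.inject map_eq_conv by (auto dest!: bspec)
qed

definition orbit :: "nat \<Rightarrow> nat set" where
  "orbit y = (\<lambda>i. (parent k ^^ i) y) ` {..k}"

text \<open>
  The path in the subdivided graph from the copy of \<open>y\<close> among the prefixes of \<open>\<sigma>\<close> to the copy of the root.
\<close>

definition ascent :: "nat list \<Rightarrow> nat \<Rightarrow> node set" where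
  "ascent \<sigma> y = (\<lambda>z. Orig (take (Suc z) \<sigma>)) ` orbit y \<union>
     (\<lambda>(z, j). Sub (take (Suc (parent k z)) \<sigma>) z j) ` ({z \<in> orbit y. Suc z < 2 ^ k} \<times> {1..4 * k})"

definition full_words :: "nat list set" where
  "full_words = {\<sigma>. set \<sigma> \<subseteq> {..<N} \<and> length \<sigma> = 2 ^ k}"

lemma orbit_self: "y \<in> orbit y"
  unfolding orbit_def by (rule image_eqI[of _ _ 0]) auto

lemma Orig_ascent: "z \<in> orbit y \<Longrightarrow> Orig (take (Suc z) \<sigma>) \<in> ascent \<sigma> y"
  by (simp add: ascent_def)

lemma parent_ge: "x < 2 ^ k \<Longrightarrow> x \<le> parent k x"
  proof (cases "Suc x < 2 ^ k")
  case True
  then show ?thesis using parent_greater[of x k] by simp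
next
  case False
  moreover assume "x < 2 ^ k"
  ultimately have "x = 2 ^ k - 1" by simp
  then show ?thesis by (simp only: parent_root)
qed

lemma orbit_bounds:
  assumes "y < 2 ^ k" "z \<in> orbit y"
  shows "y \<le> z" "z < 2 ^ k"
proof -
  have "y \<le> (parent k ^^ i) y \<and> (parent k ^^ i) y < 2 ^ k" for i
    by (induction i) (use assms(1) parent_less parent_ge in \<open>auto intro: le_trans\<close>)
  then show "y \<le> z" "z < 2 ^ k" using assms(2) by (auto simp: orbit_def)
qed

text \<open>
  After \<open>k\<close> steps the iteration has arrived at the root, which is a fixed point.
\<close>

lemma parent_orbit:
  assumes y: "y < 2 ^ k" and z: "z \<in> orbit y"
  shows "parent k z \<in> orbit y"
proof -
  obtain i where i: "i \<le> k" "z = (parent k ^^ i) y" using z by (auto simp: orbit_def)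
  show ?thesis
  proof (cases "i = k")
    case True
    have "(parent k ^^ k) y = 2 ^ k - 1" using parent_iterate[OF y depth_le] .
    then have "parent k z = z" using i True by (simp only: parent_root)
    then show ?thesis using z by simp
  next
    case False
    then show ?thesis
      using i unfolding orbit_def by (intro image_eqI[of _ _ "Suc i"]) auto
  qed
qed

lemma take_full_words: "\<sigma> \<in> full_words \<Longrightarrow> take (Suc z) \<sigma> \<in> words"
  using N by (auto simp: full_words_def words_def dest: in_set_takeD)

lemma joined_take: "\<sigma> \<in> full_words \<Longrightarrow> Suc z < 2 ^ k \<Longrightarrow> joined (take (Suc (parent k z)) \<sigma>) z"
  using take_full_words parent_less[of z k] by (auto simp: joined_def full_words_def)

lemma ascent_subset: "\<sigma> \<in> full_words \<Longrightarrow> ascent \<sigma> y \<subseteq> nodes"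
  using take_full_words joined_take by (auto simp: ascent_def)

lemma finite_ascent: "finite (ascent \<sigma> y)"
  by (auto simp: ascent_def orbit_def)

lemma card_ascent: "card (ascent \<sigma> y) \<le> (k + 1) * (4 * k + 1)"
proof -
  have fin: "finite (orbit y)" by (simp add: orbit_def)
  have orb: "card (orbit y) \<le> k + 1"
    using card_image_le[of "{..k}" "\<lambda>i. (parent k ^^ i) y"] by (simp add: orbit_def)
  have "card {z \<in> orbit y. Suc z < 2 ^ k} \<le> card (orbit y)"
    using fin by (intro card_mono) auto
  then have "card ({z \<in> orbit y. Suc z < 2 ^ k} \<times> {1..4 * k}) \<le> (k + 1) * (4 * k)"
    using orb by (simp add: card_cartesian_product del: mult_Suc mult_Suc_right)
  then have "card ((\<lambda>(z, j). Sub (take (Suc (parent k z)) \<sigma>) z j) `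
      ({z \<in> orbit y. Suc z < 2 ^ k} \<times> {1..4 * k})) \<le> (k + 1) * (4 * k)"
    using fin by (intro order.trans[OF card_image_le]) auto
  moreover have "card ((\<lambda>z. Orig (take (Suc z) \<sigma>)) ` orbit y) \<le> k + 1"
    using card_image_le[OF fin] orb by (meson le_trans)
  moreover have "card (ascent \<sigma> y) \<le> card ((\<lambda>z. Orig (take (Suc z) \<sigma>)) ` orbit y) +
      card ((\<lambda>(z, j). Sub (take (Suc (parent k z)) \<sigma>) z j) `
        ({z \<in> orbit y. Suc z < 2 ^ k} \<times> {1..4 * k}))"
    unfolding ascent_def by (rule card_Un_le)
  ultimately show ?thesis by (simp add: algebra_simps)
qed

lemma adj_sym: "(u, v) \<in> (adj H)\<^sup>* \<Longrightarrow> (v, u) \<in> (adj H)\<^sup>*"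
proof -
  have "sym (adj H)" by (auto simp: sym_def adj_def insert_commute)
  then show "(u, v) \<in> (adj H)\<^sup>* \<Longrightarrow> (v, u) \<in> (adj H)\<^sup>*"
    by (meson sym_rtrancl symD)
qed

lemma arc_reach:
  "arc a b \<or> arc b a \<Longrightarrow> a \<in> X \<Longrightarrow> b \<in> X \<Longrightarrow> (to_nat a, to_nat b) \<in> (adj (graph_on X))\<^sup>*"
  by (intro r_into_rtrancl) (simp add: adj_def)

lemma ascent_reach:
  assumes \<sigma>: "\<sigma> \<in> full_words" and y: "y < 2 ^ k" and X: "ascent \<sigma> y \<subseteq> X" and a: "a \<in> ascent \<sigma> y"
  shows "(to_nat a, to_nat (Orig \<sigma>)) \<in> (adj (graph_on X))\<^sup>*" (is "_ \<in> ?R")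
proof -
  have Orig_X: "Orig (take (Suc z) \<sigma>) \<in> X" if "z \<in> orbit y" for z
    using X that by (auto simp: ascent_def)
  have Sub_X: "Sub (take (Suc (parent k z)) \<sigma>) z j \<in> X"
    if "z \<in> orbit y" "Suc z < 2 ^ k" "1 \<le> j" "j \<le> 4 * k" for z j
    using X that by (force simp: ascent_def)
  have thread: "(to_nat (Sub (take (Suc (parent k z)) \<sigma>) z j), to_nat (Orig (take (Suc (parent k z)) \<sigma>))) \<in> ?R"
    if z: "z \<in> orbit y" "Suc z < 2 ^ k" and j: "1 \<le> j" "j \<le> 4 * k" for z j
    using j
  proof (induction j rule: nat_induct_at_least)
    case base
    show ?case
      using arc.first[OF joined_take[OF \<sigma> z(2)]] Sub_X[OF z, of 1] k Orig_X[OF parent_orbit[OF y z(1)]]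
      by (intro arc_reach) auto
  next
    case (Suc j)
    have "(to_nat (Sub (take (Suc (parent k z)) \<sigma>) z (Suc j)),
        to_nat (Sub (take (Suc (parent k z)) \<sigma>) z j)) \<in> ?R"
      using arc.inner[OF joined_take[OF \<sigma> z(2)], of j] Sub_X[OF z, of j] Sub_X[OF z, of "Suc j"] Suc
      by (intro arc_reach) auto
    then show ?case using Suc.IH Suc.prems by (meson Suc_leD rtrancl_trans)
  qed
  have top: "(to_nat (Orig (take (Suc z) \<sigma>)), to_nat (Orig \<sigma>)) \<in> ?R" if "z \<in> orbit y" for z
    using that
  proof (induction "2 ^ k - z" arbitrary: z rule: less_induct)
    case less
    have z: "z < 2 ^ k" using orbit_bounds(2)[OF y less.prems] .
    show ?case
    proof (cases "Suc z < 2 ^ k")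
      case True
      have "take (Suc z) (take (Suc (parent k z)) \<sigma>) = take (Suc z) \<sigma>"
        using parent_greater[OF True] by (simp add: min_def)
      then have "(to_nat (Orig (take (Suc z) \<sigma>)), to_nat (Sub (take (Suc (parent k z)) \<sigma>) z (4 * k))) \<in> ?R"
        using arc.last[OF joined_take[OF \<sigma> True]] Orig_X[OF less.prems] Sub_X[OF less.prems True, of "4 * k"] k
        by (intro arc_reach) auto
      moreover have "(to_nat (Orig (take (Suc (parent k z)) \<sigma>)), to_nat (Orig \<sigma>)) \<in> ?R"
        using parent_greater[OF True] z by (intro less.hyps parent_orbit[OF y less.prems]) auto
      moreover have "(to_nat (Sub (take (Suc (parent k z)) \<sigma>) z (4 * k)),
          to_nat (Orig (take (Suc (parent k z)) \<sigma>))) \<in> ?R"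
        using k by (intro thread[OF less.prems True]) auto
      ultimately show ?thesis by (meson rtrancl_trans)
    next
      case False
      then show ?thesis using z \<sigma> by (simp add: full_words_def)
    qed
  qed
  from a consider z where "z \<in> orbit y" "a = Orig (take (Suc z) \<sigma>)"
    | z j where "z \<in> orbit y" "Suc z < 2 ^ k" "1 \<le> j" "j \<le> 4 * k" "a = Sub (take (Suc (parent k z)) \<sigma>) z j"
    by (auto simp: ascent_def)
  then show ?thesis
  proof cases
    case 1
    then show ?thesis using top by simp
  next
    case 2
    then show ?thesis using thread top[OF parent_orbit[OF y]] by (meson rtrancl_trans)
  qed
qed

text \<open>
  If \<open>\<sigma>\<close> and \<open>\<sigma>'\<close> carry the same colors and part right after the copy of \<open>u\<close>, then replacing \<open>\<sigma>\<close> by \<open>\<sigma>'\<close>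
  preserves colors and moves every vertex of the path except the common copy of \<open>u\<close>.  This holds since
  the path only visits numbers from \<open>u\<close> on, and a thread starting at the parent of \<open>z \<ge> u\<close> belongs to a
  word that is longer than that copy.
\<close>

lemma ascent_twin:
  assumes \<sigma>: "\<sigma> \<in> full_words" "\<sigma>' \<in> full_words"
    and prof: "\<And>z. z < 2 ^ k \<Longrightarrow> profile f (take (Suc z) \<sigma>) = profile f (take (Suc z) \<sigma>')"
    and u: "u < 2 ^ k" and split: "\<And>z. u < z \<Longrightarrow> z < 2 ^ k \<Longrightarrow> take (Suc z) \<sigma> \<noteq> take (Suc z) \<sigma>'"
    and y: "u \<le> y" "y < 2 ^ k" and a: "a \<in> ascent \<sigma> y"
  shows "\<exists>b\<in>ascent \<sigma>' y. f (to_nat b) = f (to_nat a) \<and> (b \<noteq> a \<or> a = Orig (take (Suc u) \<sigma>))"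
proof -
  from a consider z where "z \<in> orbit y" "a = Orig (take (Suc z) \<sigma>)"
    | z j where "z \<in> orbit y" "Suc z < 2 ^ k" "1 \<le> j" "j \<le> 4 * k" "a = Sub (take (Suc (parent k z)) \<sigma>) z j"
    by (auto simp: ascent_def)
  then show ?thesis
  proof cases
    case 1
    have z: "u \<le> z" "z < 2 ^ k" using orbit_bounds[OF y(2) 1(1)] y by auto
    have "Orig (take (Suc z) \<sigma>') \<in> ascent \<sigma>' y" using 1 by (auto simp: ascent_def)
    moreover have "f (to_nat (Orig (take (Suc z) \<sigma>'))) = f (to_nat a)"
      using profile_eqD(1)[OF prof[OF z(2)]] 1 by simp
    moreover have "z = u \<or> take (Suc z) \<sigma> \<noteq> take (Suc z) \<sigma>'" using split z by force
    ultimately show ?thesis using 1 by (intro bexI) auto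
  next
    case 2
    let ?b = "Sub (take (Suc (parent k z)) \<sigma>') z j"
    have z: "u < parent k z" "parent k z < 2 ^ k"
      using orbit_bounds[OF y(2) 2(1)] y parent_greater[OF 2(2)] parent_less by auto
    have b: "?b \<in> ascent \<sigma>' y" using 2 by (force simp: ascent_def)
    then have "f (to_nat ?b) = f (to_nat a)"
      using profile_eqD(2)[OF prof[OF z(2)], of z j] 2 joined_take \<sigma> by simp
    moreover have "?b \<noteq> a" using split[OF z] 2 by simp
    ultimately show ?thesis using b by blast
  qed
qed

text \<open>
  The connected subgraph that would violate the coloring: the paths to the root from \<open>u\<close> and from \<open>v\<close>, in
  both words.  Each word contributes a set of vertices in which everything is connected to the copy of
  the root, and the two sets meet in the copy of \<open>u\<close>.  The second set repeats the colors of the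
  first, so only the vertices of one word count towards the number of colors.
\<close>

lemma no_color_collision:
  assumes f: "centered_coloring p G f" and p: "2 * ((k + 1) * (4 * k + 1)) \<le> p"
    and \<sigma>: "\<sigma> \<in> full_words" "\<sigma>' \<in> full_words"
    and prof: "\<And>z. z < 2 ^ k \<Longrightarrow> profile f (take (Suc z) \<sigma>) = profile f (take (Suc z) \<sigma>')"
    and uv: "u < v" "v < 2 ^ k"
    and fork: "take (Suc u) \<sigma> = take (Suc u) \<sigma>'" "\<sigma> ! Suc u \<noteq> \<sigma>' ! Suc u"
  shows "f (to_nat (Orig (take (Suc u) \<sigma>))) \<noteq> f (to_nat (Orig (take (Suc v) \<sigma>)))"
proof
  assume eq: "f (to_nat (Orig (take (Suc u) \<sigma>))) = f (to_nat (Orig (take (Suc v) \<sigma>)))"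
  define Y where "Y = ascent \<sigma> u \<union> ascent \<sigma> v"
  define Y' where "Y' = ascent \<sigma>' u \<union> ascent \<sigma>' v"
  define X where "X = Y \<union> Y'"
  have u: "u < 2 ^ k" using uv by simp
  have split: "take (Suc z) \<sigma> \<noteq> take (Suc z) \<sigma>'" if "u < z" "z < 2 ^ k" for z
  proof
    assume "take (Suc z) \<sigma> = take (Suc z) \<sigma>'"
    then have "take (Suc z) \<sigma> ! Suc u = take (Suc z) \<sigma>' ! Suc u" by simp
    then show False using fork(2) that by simp
  qed
  have YX: "ascent \<sigma> u \<subseteq> X" "ascent \<sigma> v \<subseteq> X" "ascent \<sigma>' u \<subseteq> X" "ascent \<sigma>' v \<subseteq> X"
    by (auto simp: X_def Y_def Y'_def)
  have X: "X \<subseteq> nodes" using ascent_subset \<sigma> by (auto simp: X_def Y_def Y'_def)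
  let ?R = "(adj (graph_on X))\<^sup>*"
  have shared: "Orig (take (Suc u) \<sigma>) \<in> ascent \<sigma> u" "Orig (take (Suc u) \<sigma>) \<in> ascent \<sigma>' u"
    using Orig_ascent[OF orbit_self, of u \<sigma>] Orig_ascent[OF orbit_self, of u \<sigma>'] fork(1)
    by simp_all
  have Y_reach: "(to_nat a, to_nat (Orig \<sigma>)) \<in> ?R" if "a \<in> Y" for a
    using that ascent_reach[OF \<sigma>(1) u YX(1)] ascent_reach[OF \<sigma>(1) uv(2) YX(2)] by (auto simp: Y_def)
  have Y'_reach: "(to_nat a, to_nat (Orig \<sigma>')) \<in> ?R" if "a \<in> Y'" for a
    using that ascent_reach[OF \<sigma>(2) u YX(3)] ascent_reach[OF \<sigma>(2) uv(2) YX(4)] by (auto simp: Y'_def)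
  have "(to_nat (Orig \<sigma>'), to_nat (Orig \<sigma>)) \<in> ?R"
    using Y_reach Y'_reach adj_sym shared unfolding Y_def Y'_def by (meson UnI1 rtrancl_trans)
  then have reach: "(to_nat a, to_nat (Orig \<sigma>)) \<in> ?R" if "a \<in> X" for a
    using that Y_reach Y'_reach unfolding X_def by (meson Un_iff rtrancl_trans)
  have "connected_graph (graph_on X)"
    unfolding connected_graph_def
  proof (intro conjI ballI)
    show "verts (graph_on X) \<noteq> {}" using shared YX by auto
    fix x y assume "x \<in> verts (graph_on X)" "y \<in> verts (graph_on X)"
    then have "(x, to_nat (Orig \<sigma>)) \<in> ?R" "(y, to_nat (Orig \<sigma>)) \<in> ?R" using reach by auto
    then show "(x, y) \<in> ?R" using adj_sym by (meson rtrancl_trans)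
  qed
  then have alt: "card (f ` verts (graph_on X)) > p \<or> (\<exists>i. card (f -` {i} \<inter> verts (graph_on X)) = 1)"
    using f subgraph_on[OF X] unfolding centered_coloring_def by blast
  have twin: "\<exists>b\<in>Y'. f (to_nat b) = f (to_nat a) \<and> (b \<noteq> a \<or> a = Orig (take (Suc u) \<sigma>))" if "a \<in> Y" for a
    using that ascent_twin[OF \<sigma> prof u split _ u] ascent_twin[OF \<sigma> prof u split _ uv(2)] uv
    unfolding Y_def Y'_def by (metis UnCI UnE less_imp_le_nat order_refl)
  have twin': "\<exists>b\<in>Y. f (to_nat b) = f (to_nat a) \<and> (b \<noteq> a \<or> a = Orig (take (Suc u) \<sigma>'))" if "a \<in> Y'" for a
    using that ascent_twin[OF \<sigma>(2,1) prof[symmetric] u split[symmetric] _ u]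
      ascent_twin[OF \<sigma>(2,1) prof[symmetric] u split[symmetric] _ uv(2)] uv
    unfolding Y_def Y'_def by (metis UnCI UnE less_imp_le_nat order_refl)
  \<comment> \<open>The common copy of \<open>u\<close> is its own twin; by assumption the copy of \<open>v\<close> has its color.\<close>
  have twin_shared: "\<exists>b\<in>Y. f (to_nat b) = f (to_nat a) \<and> b \<noteq> a" if "a = Orig (take (Suc u) \<sigma>)" for a
  proof
    show "Orig (take (Suc v) \<sigma>) \<in> Y" using Orig_ascent[OF orbit_self] by (simp add: Y_def)
    have "length (take (Suc u) \<sigma>) \<noteq> length (take (Suc v) \<sigma>)"
      using \<sigma>(1) uv by (simp add: full_words_def)
    then have "take (Suc u) \<sigma> \<noteq> take (Suc v) \<sigma>" by metis
    then show "f (to_nat (Orig (take (Suc v) \<sigma>))) = f (to_nat a) \<and> Orig (take (Suc v) \<sigma>) \<noteq> a"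
      using eq that by auto
  qed
  have repeated: "\<exists>b\<in>X. f (to_nat b) = f (to_nat a) \<and> b \<noteq> a" if "a \<in> X" for a
    using that twin twin' twin_shared fork(1) unfolding X_def by (metis UnE UnI1 UnI2)
  have "card (f -` {i} \<inter> verts (graph_on X)) \<noteq> 1" for i
  proof
    assume "card (f -` {i} \<inter> verts (graph_on X)) = 1"
    then obtain v where v: "f -` {i} \<inter> to_nat ` X = {v}"
      unfolding verts_graph_on by (rule card_1_singletonE)
    then have "v \<in> f -` {i} \<inter> to_nat ` X" by simp
    then obtain a where a: "a \<in> X" "v = to_nat a" "f (to_nat a) = i" by auto
    obtain b where b: "b \<in> X" "f (to_nat b) = f (to_nat a)" "b \<noteq> a"
      using repeated[OF a(1)] by blast
    then have "to_nat b \<in> f -` {i} \<inter> to_nat ` X" using a(3) by simp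
    then show False using v a(2) b(3) by simp
  qed
  moreover have "card (f ` verts (graph_on X)) \<le> p"
  proof -
    have fin: "finite Y" using finite_ascent by (simp add: Y_def)
    have "f ` verts (graph_on X) \<subseteq> f ` to_nat ` Y"
    proof
      fix c assume "c \<in> f ` verts (graph_on X)"
      then obtain a where "a \<in> X" "c = f (to_nat a)" by auto
      then show "c \<in> f ` to_nat ` Y" using twin' unfolding X_def by (metis UnE imageI)
    qed
    then have "card (f ` verts (graph_on X)) \<le> card (f ` to_nat ` Y)"
      using fin by (intro card_mono) auto
    also have "\<dots> \<le> card Y" using card_image_le fin by (metis finite_imageI le_trans)
    also have "\<dots> \<le> card (ascent \<sigma> u) + card (ascent \<sigma> v)"
      unfolding Y_def by (rule card_Un_le)
    also have "\<dots> \<le> p" using card_ascent[of \<sigma> u] card_ascent[of \<sigma> v] p by linarith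
    finally show ?thesis .
  qed
  ultimately show False using alt by simp
qed

text \<open>
  The color of a copy of \<open>z\<close> is the head of its profile.  By homogeneity it depends only on \<open>z\<close> on the words
  considered, and by \<open>no_color_collision\<close> it determines \<open>z\<close>.
\<close>

lemma many_colors:
  assumes f: "centered_coloring p G f" and p: "2 * ((k + 1) * (4 * k + 1)) \<le> p"
    and big: "((2 ^ k) ^ Suc (2 ^ k * Suc (4 * k))) ^ 2 ^ k < N"
  shows "2 ^ k \<le> card (f ` verts G)"
proof (rule ccontr)
  assume few: "\<not> ?thesis"
  let ?C = "f ` verts G" and ?l = "Suc (2 ^ k * Suc (4 * k))"
  define T where "T = {xs. set xs \<subseteq> ?C \<and> length xs = ?l}"
  have C: "finite ?C" using finite_nodes by simp
  have T: "finite T" unfolding T_def by (rule finite_lists_length_eq[OF C])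
  have "card T = card ?C ^ ?l" unfolding T_def by (rule card_lists_length_eq[OF C])
  also have "\<dots> \<le> (2 ^ k) ^ ?l" using few by (intro power_mono) auto
  finally have cardT: "card T \<le> (2 ^ k) ^ ?l" .
  have prof: "profile f \<tau> \<in> T" if "\<tau> \<noteq> []" "set \<tau> \<subseteq> {..<N}" "length \<tau> \<le> 2 ^ k" for \<tau>
    using set_profile[of \<tau> f] length_profile that by (simp add: T_def words_def)
  obtain \<rho> where \<rho>: "length \<rho> = 2 ^ k" "set \<rho> \<subseteq> T"
    and forks: "\<And>i. i < 2 ^ k \<Longrightarrow> \<exists>\<sigma> \<sigma>'. realizes (profile f) N [] \<rho> \<sigma> \<and>
      realizes (profile f) N [] \<rho> \<sigma>' \<and> take i \<sigma> = take i \<sigma>' \<and> \<sigma> ! i \<noteq> \<sigma>' ! i"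
    using homogeneous_words[of T _ _ _ "profile f" "[]" "2 ^ k", OF T cardT _ big prof] by auto
  have "inj_on (\<lambda>z. hd (\<rho> ! z)) {..<2 ^ k}"
  proof (rule linorder_inj_onI)
    fix u v :: nat assume uv: "u < v" "u \<in> {..<2 ^ k}" "v \<in> {..<2 ^ k}"
    then have "Suc u < 2 ^ k" by simp
    from forks[OF this] obtain \<sigma> \<sigma>' where r: "realizes (profile f) N [] \<rho> \<sigma>"
      "realizes (profile f) N [] \<rho> \<sigma>'" and fork: "take (Suc u) \<sigma> = take (Suc u) \<sigma>'" "\<sigma> ! Suc u \<noteq> \<sigma>' ! Suc u"
      by blast
    have full: "\<sigma> \<in> full_words" "\<sigma>' \<in> full_words"
      using r \<rho> by (auto simp: realizes_def full_words_def)
    have pr: "profile f (take (Suc z) \<sigma>) = \<rho> ! z" "profile f (take (Suc z) \<sigma>') = \<rho> ! z" if "z < 2 ^ k" for z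
      using r that \<rho> by (auto simp: realizes_def)
    have hd: "hd (\<rho> ! z) = f (to_nat (Orig (take (Suc z) \<sigma>)))" if "z < 2 ^ k" for z
      using pr(1)[OF that] by (simp add: profile_def flip: pr(1)[OF that])
    show "hd (\<rho> ! u) \<noteq> hd (\<rho> ! v)"
      using no_color_collision[OF f p full _ uv(1) _ fork] pr hd uv by auto
  qed auto
  moreover have "(\<lambda>z. hd (\<rho> ! z)) ` {..<2 ^ k} \<subseteq> ?C"
  proof
    fix c assume "c \<in> (\<lambda>z. hd (\<rho> ! z)) ` {..<2 ^ k}"
    then obtain z where z: "z < 2 ^ k" "c = hd (\<rho> ! z)" by auto
    then have "\<rho> ! z \<in> T" using \<rho> by auto
    then show "c \<in> ?C" using z unfolding T_def by (auto dest!: subsetD[OF _ hd_in_set])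
  qed
  ultimately have "card {..<2 ^ k :: nat} \<le> card ?C" using C by (rule card_inj_on_le)
  then show False using few by simp
qed

text \<open>
  For small \<open>p\<close>, where \<open>many_colors\<close> says nothing, it suffices that the coloring is proper.
\<close>

lemma two_colors:
  assumes f: "centered_coloring p G f" and p: "1 \<le> p"
  shows "2 \<le> card (f ` verts G)"
proof (rule ccontr)
  assume few: "\<not> ?thesis"
  \<comment> \<open>Some copy of the parent of \<open>0\<close>, at which a thread starts.\<close>
  let ?\<tau> = "replicate (Suc (parent k 0)) 0"
  have k1: "Suc 0 < 2 ^ k" using one_less_power[of "2::nat" k] k by simp
  have "parent k 0 < 2 ^ k" by (rule parent_less) simp
  then have "joined ?\<tau> 0" using k1 N by (auto simp: joined_def words_def)
  then have ab: "arc (Orig ?\<tau>) (Sub ?\<tau> 0 1)" and nodes: "{Orig ?\<tau>, Sub ?\<tau> 0 1} \<subseteq> nodes"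
    using k by (auto intro: arc.first[simplified] simp: joined_def)
  let ?H = "graph_on {Orig ?\<tau>, Sub ?\<tau> 0 1}"
  have "connected_graph ?H"
    unfolding connected_graph_def
    using arc_reach[of "Orig ?\<tau>" "Sub ?\<tau> 0 1" "{Orig ?\<tau>, Sub ?\<tau> 0 1}"]
      arc_reach[of "Sub ?\<tau> 0 1" "Orig ?\<tau>" "{Orig ?\<tau>, Sub ?\<tau> 0 1}"] ab by auto
  then have alt: "card (f ` verts ?H) > p \<or> (\<exists>i. card (f -` {i} \<inter> verts ?H) = 1)"
    using f subgraph_on[OF nodes] unfolding centered_coloring_def by blast
  have sub: "f ` verts ?H \<subseteq> f ` verts G" using nodes by auto
  have C: "finite (f ` verts G)" using finite_nodes by simp
  have le: "card (f ` verts ?H) \<le> 1" using few card_mono[OF C sub] by simp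
  then have "f (to_nat (Orig ?\<tau>)) = f (to_nat (Sub ?\<tau> 0 1))"
    by (auto simp: card_insert_if split: if_splits)
  then have "f -` {i} \<inter> verts ?H = {} \<or> f -` {i} \<inter> verts ?H = {to_nat (Orig ?\<tau>), to_nat (Sub ?\<tau> 0 1)}" for i
    by auto
  then have "card (f -` {i} \<inter> verts ?H) \<noteq> 1" for i
    by (metis card.empty card_2_iff from_nat_to_nat node.distinct(1) numeral_eq_one_iff
        semiring_norm(85) zero_neq_one)
  then show False using alt le p by simp
qed

end

section \<open>Choice of the parameters\<close>

text \<open>
  The alphabet has just one letter more than there are sequences of \<open>2 ^ k\<close> profiles over \<open>2 ^ k\<close> colors.
\<close>

definition hard_graph :: "nat \<Rightarrow> nat graph" where
  "hard_graph k = blowup.G k (Suc (((2 ^ k) ^ Suc (2 ^ k * Suc (4 * k))) ^ 2 ^ k))"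

lemma blowup_hard: "0 < k \<Longrightarrow> blowup k (Suc (((2 ^ k) ^ Suc (2 ^ k * Suc (4 * k))) ^ 2 ^ k))"
  by (simp add: blowup_def)

theorem theorem1p1:
  "\<exists>(\<G> :: nat graph set) (c :: real). c > 0 \<and>
     (\<forall>G\<in>\<G>. simple_graph G) \<and>
     (\<forall>r :: nat. nabla_class r \<G> \<le> ereal (real r + 2)) \<and>
     (\<forall>p :: nat. p \<ge> 1 \<longrightarrow>
        (\<exists>G\<in>\<G>. \<forall>f. centered_coloring p G f \<longrightarrow>
           real (card (f ` verts G)) \<ge> 2 powr (c * real p powr (1 / 2))))"
proof (intro exI[of _ "hard_graph ` {0<..}"] exI[of _ "1 / 10"] conjI allI impI ballI)
  show "(0::real) < 1 / 10" by simp
  show "simple_graph G" if "G \<in> hard_graph ` {0<..}" for G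
    using that blowup.simple_graph_on[OF blowup_hard] by (auto simp: hard_graph_def)
  show "nabla_class r (hard_graph ` {0<..}) \<le> ereal (real r + 2)" for r
    unfolding nabla_class_def
    using blowup.nabla_G[OF blowup_hard] by (auto intro!: SUP_least simp: hard_graph_def)
  fix p :: nat assume p: "1 \<le> p"
  show "\<exists>G\<in>hard_graph ` {0<..}. \<forall>f. centered_coloring p G f \<longrightarrow>
      2 powr (1 / 10 * real p powr (1 / 2)) \<le> real (card (f ` verts G))"
  proof (cases "p < 20")
    case True
    \<comment> \<open>Two colors are enough as long as \<open>sqrt p / 10 \<le> 1\<close>.\<close>
    have "sqrt (real p) \<le> sqrt (10 ^ 2)" using True by (intro real_sqrt_le_mono) simp
    then have "2 powr (1 / 10 * real p powr (1 / 2)) \<le> 2 powr (1::real)"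
      by (intro powr_mono) (simp_all add: powr_half_sqrt)
    moreover have "2 \<le> card (f ` verts (hard_graph 1))" if "centered_coloring p (hard_graph 1) f" for f
      unfolding hard_graph_def
      by (rule blowup.two_colors[OF blowup_hard that[unfolded hard_graph_def] p]) simp
    ultimately show ?thesis by (intro bexI[of _ "hard_graph 1"]) fastforce+
  next
    case False
    \<comment> \<open>The paths in \<open>no_color_collision\<close> have at most \<open>2 * (k + 1) * (4 * k + 1) \<le> 20 * k\<^sup>2\<close> vertices in one word.\<close>
    define k where "k = nat \<lfloor>sqrt (real p / 20)\<rfloor>"
    have k0: "1 \<le> sqrt (real p / 20)" using False by (simp add: real_le_rsqrt)
    have k: "0 < k" "real k \<le> sqrt (real p / 20)" "sqrt (real p / 20) < real k + 1"
      using k0 unfolding k_def by linarith+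
    have "(real k)\<^sup>2 \<le> real p / 20" using k(2) by (metis of_nat_0_le_iff real_sqrt_ge_0_iff real_le_rsqrt sqrt_ge_absD abs_of_nat)
    then have "20 * (real k * real k) \<le> real p" by (simp add: power2_eq_square)
    then have "20 * (k * k) \<le> p" by (metis of_nat_le_iff of_nat_mult of_nat_numeral)
    moreover have "2 * ((k + 1) * (4 * k + 1)) \<le> 2 * ((2 * k) * (5 * k))"
      using k(1) by (intro mult_le_mono) auto
    ultimately have kp: "2 * ((k + 1) * (4 * k + 1)) \<le> p" by simp
    \<comment> \<open>Rounding down to a positive integer loses at most a factor of two.\<close>
    have "sqrt (real p) / 10 \<le> real k"
    proof -
      have "sqrt (real p / 20) \<le> 2 * real k" using k by linarith
      moreover have "sqrt (real p) / 5 \<le> sqrt (real p / 20)"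
        by (rule real_le_rsqrt) (simp add: power_divide)
      ultimately show ?thesis by simp
    qed
    then have "2 powr (1 / 10 * real p powr (1 / 2)) \<le> 2 powr real k"
      by (intro powr_mono) (simp_all add: powr_half_sqrt)
    then have "2 powr (1 / 10 * real p powr (1 / 2)) \<le> real (2 ^ k)"
      by (simp add: powr_realpow)
    moreover have "2 ^ k \<le> card (f ` verts (hard_graph k))" if "centered_coloring p (hard_graph k) f" for f
      unfolding hard_graph_def
      by (rule blowup.many_colors[OF blowup_hard[OF k(1)] that[unfolded hard_graph_def] kp lessI])
    ultimately show ?thesis
      using k(1) by (intro bexI[of _ "hard_graph k"]) (force intro: order_trans)+
  qed
qed

end
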